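(* For every $\varepsilon>0$ there exist constants $C_0,\delta_0>0$, depending only on $\varepsilon$, such that the following holds. Let $E$ be an $n\times n$ Bernoulli random matrix and let $A$ be a deterministic real $n\times n$ matrix of rank $r$ with largest singular value $\sigma_1$ and gap $\delta=\sigma_1-\sigma_2$. If $\delta\ge\delta_0$ and $\sigma_1\ge\max\{n,\sqrt n\,\delta\}$, then, with probability at least $1-\varepsilon$, $$\sin\angle(v_1,v_1')\le C_0\,\frac{\sqrt r}{\delta}.$$
   Context: A Bernoulli random matrix has independent identically distributed entries taking the values $\pm1$ with probability $1/2$ each. Singular values of $A$ are $\sigma_1\ge\sigma_2\ge\cdots\ge\sigma_n\ge0$ (with $\sigma_k:=0$ for $k>n$). $v_1$ denotes a unit singular vector of $A$ corresponding to its largest singular value, and $v_1'$ a unit singular vector of $A+E$ corresponding to the largest singular value of $A+E$ (any choice). "Singular vector" may be read as left-singular vector or as right-singular vector, the same choice being made for $A$ and $A+E$; the result holds for either choice. For unit vectors $v,v'$, $\angle(v,v')$ is the angle taken in $[0,\pi/2]$, so $\sin\angle(v,v')=\sqrt{1-(v\cdot v')^2}$. *)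

theory Defs
  imports
    "HOL-Probability.Product_PMF"
    "Jordan_Normal_Form.Char_Poly"
    "Jordan_Normal_Form.DL_Rank"
begin

definition bernoulli_matrix_pmf :: "nat \<Rightarrow> real mat pmf" where
  "bernoulli_matrix_pmf n =
     map_pmf (\<lambda>e. mat n n e)
       (Pi_pmf ({..<n} \<times> {..<n}) 0 (\<lambda>_. pmf_of_set {-1, 1}))"

text \<open>The singular values are the square roots of the eigenvalues of \<open>A\<^sup>T A\<close>, listed with
  algebraic multiplicity in decreasing order. No eigenvalue is lost by taking roots over the reals,
  since \<open>A\<^sup>T A\<close> is symmetric and positive semidefinite.\<close>

definition singular_values :: "real mat \<Rightarrow> real list" where
  "singular_values A =
     rev (sorted_list_of_multiset
       (image_mset sqrt (proots (char_poly (transpose_mat A * A)))))"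

text \<open>Indexing starts at 1.\<close>

definition singular_value :: "real mat \<Rightarrow> nat \<Rightarrow> real" where
  "singular_value A k =
     (if 1 \<le> k \<and> k \<le> length (singular_values A) then singular_values A ! (k - 1) else 0)"

definition unit_vector :: "nat \<Rightarrow> real Matrix.vec \<Rightarrow> bool" where
  "unit_vector n v \<longleftrightarrow> v \<in> carrier_vec n \<and> scalar_prod v v = 1"

definition singular_pair ::
    "real mat \<Rightarrow> real \<Rightarrow> real Matrix.vec \<Rightarrow> real Matrix.vec \<Rightarrow> bool" where
  "singular_pair A s u v \<longleftrightarrow>
     unit_vector (dim_row A) u \<and> unit_vector (dim_col A) v \<and>
     A *\<^sub>v v = s \<cdot>\<^sub>v u \<and> transpose_mat A *\<^sub>v u = s \<cdot>\<^sub>v v"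

definition left_singular_vector :: "real mat \<Rightarrow> real \<Rightarrow> real Matrix.vec \<Rightarrow> bool" where
  "left_singular_vector A s u \<longleftrightarrow> (\<exists>v. singular_pair A s u v)"

definition right_singular_vector :: "real mat \<Rightarrow> real \<Rightarrow> real Matrix.vec \<Rightarrow> bool" where
  "right_singular_vector A s v \<longleftrightarrow> (\<exists>u. singular_pair A s u v)"

text \<open>For unit vectors; the absolute value places the angle in \<open>[0, pi/2]\<close>.\<close>

definition vec_angle :: "real Matrix.vec \<Rightarrow> real Matrix.vec \<Rightarrow> real" where
  "vec_angle v w = arccos \<bar>scalar_prod v w\<bar>"

end

theory Submission
  imports Defs "HOL-Probability.Hoeffding" "Jordan_Normal_Form.Schur_Decomposition"
    "Jordan_Normal_Form.Spectral_Radius"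
begin

text \<open>Write \<open>P'\<close> for the projection onto the row space of \<open>A\<close>. For fixed orthonormal bases \<open>U\<close>, \<open>V\<close>
  of the column and the row space, Hoeffding's inequality and a union bound over a net of \<open>L\<^sup>r\<close> points give
  \<open>\<parallel>U\<^sup>T E V\<parallel> \<le> K \<surd>r\<close> with high probability; the same estimate for \<open>U = V = 1\<close> gives \<open>\<parallel>E\<parallel> \<le> K \<surd>n\<close>.
  Let \<open>u', v'\<close> be the top singular vectors of \<open>A + E\<close> with singular value \<open>\<sigma>'\<close>. The part \<open>w\<close> of \<open>v'\<close>
  outside the row space satisfies \<open>\<sigma>' w = (1 - P') E\<^sup>T u'\<close>, hence \<open>|w| \<le> K \<surd>n / \<sigma>'\<close>, and likewise for \<open>u'\<close>.
  Projecting \<open>(A + E) v' = \<sigma>' u'\<close> to the complement of \<open>u\<close> in the column space bounds the remaining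
  components \<open>p\<close>, \<open>s\<close> of \<open>u'\<close>, \<open>v'\<close> by \<open>\<sigma>' |p| \<le> \<sigma>\<^sub>2 |s| + K \<surd>r + K \<surd>n |w|\<close>, where
  \<open>K \<surd>n |w|\<close> is bounded because \<open>\<sigma>\<^sub>1 \<ge> n\<close>. Adding the symmetric inequality gives
  \<open>(\<sigma>' - \<sigma>\<^sub>2) (|p| + |s|) \<le> 2 K \<surd>r + O(1)\<close>, and \<open>\<sigma>' - \<sigma>\<^sub>2 \<ge> \<delta> - K \<surd>r \<ge> \<delta> / 2\<close> unless the claim is
  trivial.\<close>

section \<open>Norms of vectors and the Rademacher tail bound\<close>

unbundle no vec_syntax
unbundle no inner_syntax

definition vnorm :: "real Matrix.vec \<Rightarrow> real" where
  "vnorm v = sqrt (v \<bullet> v)"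

lemma vnorm_eq_L2_set: "vnorm v = L2_set (\<lambda>i. v $ i) {0..<dim_vec v}"
  by (simp add: vnorm_def L2_set_def scalar_prod_def power2_eq_square)

lemma vnorm_nonneg [simp]: "0 \<le> vnorm v"
  by (simp add: vnorm_eq_L2_set)

lemma vnorm_square: "(vnorm v)\<^sup>2 = v \<bullet> v"
  by (simp add: vnorm_def scalar_prod_def sum_nonneg)

lemma vnorm_mult_self: "vnorm v * vnorm v = v \<bullet> v"
  using vnorm_square[of v] by (simp add: power2_eq_square)

lemma vnorm_eq_0_imp:
  assumes "v \<in> carrier_vec n" "vnorm v = 0"
  shows "v = 0\<^sub>v n"
  using assms by (auto simp: vnorm_eq_L2_set L2_set_eq_0_iff intro!: eq_vecI)

lemma vnorm_zero [simp]: "vnorm (0\<^sub>v n) = 0"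
  by (simp add: vnorm_def)

lemma Cauchy_Schwarz_vec:
  assumes "x \<in> carrier_vec n" "y \<in> carrier_vec n"
  shows "x \<bullet> y \<le> vnorm x * vnorm y"
proof -
  have "x \<bullet> y \<le> (\<Sum>i\<in>{0..<n}. \<bar>x $ i\<bar> * \<bar>y $ i\<bar>)"
    using assms by (auto simp: scalar_prod_def abs_mult[symmetric] intro!: sum_mono)
  also have "\<dots> \<le> vnorm x * vnorm y"
    using L2_set_mult_ineq[of "\<lambda>i. x $ i" "\<lambda>i. y $ i" "{0..<n}"] assms by (simp add: vnorm_eq_L2_set)
  finally show ?thesis .
qed

lemma vnorm_smult: "vnorm (c \<cdot>\<^sub>v x) = \<bar>c\<bar> * vnorm x"
proof -
  have "(c \<cdot>\<^sub>v x) \<bullet> (c \<cdot>\<^sub>v x) = c\<^sup>2 * (x \<bullet> x)"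
    by (simp add: scalar_prod_def sum_distrib_left power2_eq_square ac_simps)
  then show ?thesis by (simp add: vnorm_def real_sqrt_mult)
qed

lemma scalar_prod_mult_mat_vec:
  assumes "A \<in> carrier_mat n m" "x \<in> carrier_vec n" "y \<in> carrier_vec m"
  shows "x \<bullet> (A *\<^sub>v y) = (A\<^sup>T *\<^sub>v x) \<bullet> (y :: real Matrix.vec)"
  using transpose_vec_mult_scalar[OF assms(1,3,2)] by simp

text \<open>Hoeffding's inequality: each summand lies in an interval of length
  \<open>2 * \<bar>a i\<bar>\<close>, so the squared lengths add up to at most 4 and the exponent
  \<open>- 2 * t\<^sup>2 / 4\<close> results.\<close>

lemma rademacher_tail:
  fixes a :: "'i \<Rightarrow> real"
  assumes "finite I" "(\<Sum>i\<in>I. (a i)\<^sup>2) \<le> 1" "t > 0"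
  shows "measure_pmf.prob (Pi_pmf I 0 (\<lambda>_. pmf_of_set {-1, 1})) {e. t \<le> (\<Sum>i\<in>I. a i * e i)}
    \<le> exp (- t\<^sup>2 / 2)"
\<comment> \<open>Hoeffding's bound divides by the sum of squares. If that sum vanishes, the event
  is empty because \<open>t > 0\<close>.\<close>
proof (cases "(\<Sum>i\<in>I. (a i)\<^sup>2) = 0")
  case True
  then have "\<forall>i\<in>I. a i = 0" using assms(1) by (simp add: sum_nonneg_eq_0_iff)
  then have "{e. t \<le> (\<Sum>i\<in>I. a i * e i)} = {}" using assms(3) by auto
  then show ?thesis by simp
next
  case False
  define p where "p = (Pi_pmf I 0 (\<lambda>_. pmf_of_set {-1, 1 :: real}))"
  have pos: "(\<Sum>i\<in>I. (a i)\<^sup>2) > 0" using False sum_nonneg[of I "\<lambda>i. (a i)\<^sup>2"] by simp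
  interpret Hoeffding_ineq "measure_pmf p" I "\<lambda>i e. a i * e i" "\<lambda>i. - \<bar>a i\<bar>" "\<lambda>i. \<bar>a i\<bar>"
    "\<Sum>i\<in>I. measure_pmf.expectation p (\<lambda>e. a i * e i)"
  proof unfold_locales
    show "finite I" by fact
    show "prob_space.indep_vars (measure_pmf p) (\<lambda>_. borel) (\<lambda>i e. a i * e i) I"
      unfolding p_def
      by (intro prob_space.indep_vars_compose2[OF _ indep_vars_Pi_pmf])
         (auto simp: measure_pmf.prob_space_axioms assms(1))
    show "AE e in measure_pmf p. a i * e i \<in> {- \<bar>a i\<bar>..\<bar>a i\<bar>}" if "i \<in> I" for i
    proof -
      have "e i \<in> {-1, 1}" if "e \<in> set_pmf p" for e
        using that \<open>i \<in> I\<close> assms(1) by (auto simp: p_def set_Pi_pmf PiE_dflt_def)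
      then show ?thesis by (force simp: AE_measure_pmf_iff)
    qed
  qed simp
  have "measure_pmf.expectation p (\<lambda>e. a i * e i) = 0" if "i \<in> I" for i
  proof -
    have "measure_pmf.expectation p (\<lambda>e. a i * e i) =
        measure_pmf.expectation (map_pmf (\<lambda>e. e i) p) (\<lambda>x. a i * x)" by simp
    also have "map_pmf (\<lambda>e. e i) p = pmf_of_set {-1, 1}"
      unfolding p_def using that assms(1) by (simp add: Pi_pmf_component)
    finally show ?thesis by (simp add: integral_pmf_of_set)
  qed
  then have mu: "(\<Sum>i\<in>I. measure_pmf.expectation p (\<lambda>e. a i * e i)) = 0" by simp
  have "(\<Sum>i\<in>I. (\<bar>a i\<bar> - - \<bar>a i\<bar>)\<^sup>2) = 4 * (\<Sum>i\<in>I. (a i)\<^sup>2)"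
    by (simp add: sum_distrib_left power2_eq_square)
  with Hoeffding_ineq_ge[of t] pos assms(3) mu
  have "measure_pmf.prob p {e. t \<le> (\<Sum>i\<in>I. a i * e i)} \<le> exp (- 2 * t\<^sup>2 / (4 * (\<Sum>i\<in>I. (a i)\<^sup>2)))"
    by simp
  also have "\<dots> \<le> exp (- t\<^sup>2 / 2)"
    using pos assms(2,3) by (simp add: divide_simps mult_left_le)
  finally show ?thesis unfolding p_def .
qed

section \<open>Counting lattice points in a ball\<close>

text \<open>Two geometric series, with the term at 0 counted twice. The constant 4 becomes the
  factor per coordinate in the lattice point count below.\<close>

lemma sum_half_powers_int_le: "(\<Sum>z\<in>{- int m..int m}. (1/2::real) ^ nat \<bar>z\<bar>) \<le> 4"
proof -
  have "(\<Sum>z\<in>{- int m..int m}. (1/2::real) ^ nat \<bar>z\<bar>)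
      \<le> (\<Sum>z\<in>int ` {0..m} \<union> (\<lambda>k. - int k) ` {0..m}. (1/2::real) ^ nat \<bar>z\<bar>)"
  proof (rule sum_mono2)
    show "{- int m..int m} \<subseteq> int ` {0..m} \<union> (\<lambda>k. - int k) ` {0..m}"
    proof
      fix z assume "z \<in> {- int m..int m}"
      then have "z = int (nat \<bar>z\<bar>) \<or> z = - int (nat \<bar>z\<bar>)" "nat \<bar>z\<bar> \<in> {0..m}" by auto
      then show "z \<in> int ` {0..m} \<union> (\<lambda>k. - int k) ` {0..m}" by blast
    qed
  qed auto
  also have "\<dots> \<le> (\<Sum>z\<in>int ` {0..m}. (1/2::real) ^ nat \<bar>z\<bar>) + (\<Sum>z\<in>(\<lambda>k. - int k) ` {0..m}. (1/2::real) ^ nat \<bar>z\<bar>)"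
    using sum.union_inter[of "int ` {0..m}" "(\<lambda>k. - int k) ` {0..m}" "\<lambda>z. (1/2::real) ^ nat \<bar>z\<bar>"]
      sum_nonneg[of "int ` {0..m} \<inter> (\<lambda>k. - int k) ` {0..m}" "\<lambda>z. (1/2::real) ^ nat \<bar>z\<bar>"]
    by simp
  also have "\<dots> = 2 * (\<Sum>k\<in>{0..m}. (1/2::real) ^ k)"
    by (simp add: sum.reindex inj_on_def o_def)
  also have "\<dots> \<le> 4"
    using sum_gp0[of "1/2::real" m] by (simp add: atLeast0AtMost)
  finally show ?thesis .
qed

text \<open>Exponential weights give a bound of the form constant to the power \<open>r\<close>.
  Since \<open>\<bar>k\<bar> \<le> k\<^sup>2\<close> for integers, a counted point has
  \<open>\<Sum>\<bar>z i\<bar> \<le> c * r\<close>, so its weight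
  \<open>2 ^ (c * r) * \<Prod>(1/2) ^ \<bar>z i\<bar>\<close> is at least 1. The total weight of a
  surrounding box factors into \<open>r\<close> sums over one coordinate.\<close>

lemma card_int_ball_le:
  "finite {z \<in> {..<r} \<rightarrow>\<^sub>E (UNIV :: int set). (\<Sum>i<r. (z i)\<^sup>2) \<le> int (c * r)}"
  "real (card {z \<in> {..<r} \<rightarrow>\<^sub>E (UNIV :: int set). (\<Sum>i<r. (z i)\<^sup>2) \<le> int (c * r)}) \<le> (4 * 2 ^ c) ^ r"
proof -
  let ?Z = "{z \<in> {..<r} \<rightarrow>\<^sub>E (UNIV :: int set). (\<Sum>i<r. (z i)\<^sup>2) \<le> int (c * r)}"
  \<comment> \<open>The box serves to make the sum finite and to exchange sum and product; its
    cardinality never enters the bound.\<close>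
  let ?B = "{..<r} \<rightarrow>\<^sub>E {- int (c * r)..int (c * r)}"
  have self_le_square: "\<bar>k\<bar> \<le> k\<^sup>2" for k :: int
    using self_le_power[of "\<bar>k\<bar>" 2] by (cases "k = 0") auto
  have sub: "?Z \<subseteq> ?B"
  proof
    fix z assume z: "z \<in> ?Z"
    have "\<bar>z i\<bar> \<le> int (c * r)" if "i < r" for i
    proof -
      have "\<bar>z i\<bar> \<le> (z i)\<^sup>2" by (rule self_le_square)
      also have "\<dots> \<le> (\<Sum>i<r. (z i)\<^sup>2)" using that by (intro member_le_sum) auto
      finally show ?thesis using z by simp
    qed
    then show "z \<in> ?B" using z by (simp add: PiE_iff abs_le_iff minus_le_iff)
  qed
  have finB: "finite ?B" by (intro finite_PiE) auto
  then show fin: "finite ?Z" using sub by (rule finite_subset[rotated])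
  have "real (card ?Z) = (\<Sum>z\<in>?Z. 1)" by simp
  also have "\<dots> \<le> (\<Sum>z\<in>?Z. 2 ^ (c * r) * (\<Prod>i<r. (1/2::real) ^ nat \<bar>z i\<bar>))"
  proof (rule sum_mono)
    fix z assume z: "z \<in> ?Z"
    have "int (\<Sum>i<r. nat \<bar>z i\<bar>) \<le> (\<Sum>i<r. (z i)\<^sup>2)"
      by (auto simp: self_le_square intro!: sum_mono)
    then have "(\<Sum>i<r. nat \<bar>z i\<bar>) \<le> c * r" using z
      by (simp only: mem_Collect_eq of_nat_le_iff[where 'a=int, symmetric]) linarith
    then have "(2::real) ^ (\<Sum>i<r. nat \<bar>z i\<bar>) \<le> 2 ^ (c * r)" by (intro power_increasing) auto
    then have "(1::real) \<le> 2 ^ (c * r) / 2 ^ (\<Sum>i<r. nat \<bar>z i\<bar>)"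
      by (subst le_divide_eq_1_pos) simp_all
    also have "\<dots> = 2 ^ (c * r) * (1/2) ^ (\<Sum>i<r. nat \<bar>z i\<bar>)" by (simp only: power_one_over) simp
    also have "(1/2::real) ^ (\<Sum>i<r. nat \<bar>z i\<bar>) = (\<Prod>i<r. (1/2) ^ nat \<bar>z i\<bar>)" by (rule power_sum)
    finally show "1 \<le> 2 ^ (c * r) * (\<Prod>i<r. (1/2::real) ^ nat \<bar>z i\<bar>)" .
  qed
  also have "\<dots> \<le> (\<Sum>z\<in>?B. 2 ^ (c * r) * (\<Prod>i<r. (1/2::real) ^ nat \<bar>z i\<bar>))"
    by (rule sum_mono2[OF finB sub]) (simp add: prod_nonneg)
  also have "\<dots> = 2 ^ (c * r) * (\<Prod>i<r. \<Sum>k\<in>{- int (c * r)..int (c * r)}. (1/2::real) ^ nat \<bar>k\<bar>)"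
    by (simp only: sum_distrib_left[symmetric]
        prod_sum_PiE[of "{..<r}" "\<lambda>_. {- int (c * r)..int (c * r)}" "\<lambda>_ k. (1/2::real) ^ nat \<bar>k\<bar>",
          OF finite_lessThan finite_atLeastAtMost_int])
  also have "\<dots> \<le> 2 ^ (c * r) * 4 ^ r"
    using sum_half_powers_int_le[of "c * r"] unfolding prod_constant card_lessThan
    by (intro mult_left_mono power_mono sum_nonneg) simp_all
  finally show "real (card ?Z) \<le> (4 * 2 ^ c) ^ r"
    by (simp add: power_mult power_mult_distrib ac_simps)
qed

section \<open>A net of the unit ball and compressions of the random matrix\<close>

lemma vnorm_le_one_iff: "vnorm x \<le> 1 \<longleftrightarrow> (\<Sum>i<dim_vec x. (x $ i)\<^sup>2) \<le> 1"
  by (simp add: vnorm_def scalar_prod_def power2_eq_square atLeast0LessThan)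

lemma abs_index_le_vnorm: "i < dim_vec x \<Longrightarrow> \<bar>x $ i\<bar> \<le> vnorm x"
  using member_le_L2_set[of "{0..<dim_vec x}" i "\<lambda>i. \<bar>x $ i\<bar>"]
  by (simp add: vnorm_eq_L2_set L2_set_def)

text \<open>The net is the part of the grid of mesh \<open>1 / (4 * sqrt r)\<close> inside the unit
  ball. Rounding moves each coordinate by at most the mesh, hence a vector by at most 1/4. The count
  with \<open>c = 16\<close> gives \<open>4 * 2 ^ 16 = 2 ^ 18\<close> per dimension.\<close>

lemma ball_net_exists:
  assumes "r > 0"
  obtains N where "finite N" "N \<subseteq> carrier_vec r" "real (card N) \<le> (2 ^ 18) ^ r"
    "\<And>y. y \<in> N \<Longrightarrow> vnorm y \<le> 1"
    "\<And>x. x \<in> carrier_vec r \<Longrightarrow> vnorm x \<le> 1 \<Longrightarrow> \<exists>y\<in>N. vnorm (x - y) \<le> 1 / 4"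
proof -
  define Z where "Z = {z \<in> {..<r} \<rightarrow>\<^sub>E (UNIV :: int set). (\<Sum>i<r. (z i)\<^sup>2) \<le> int (16 * r)}"
  define pt where "pt z = Matrix.vec r (\<lambda>i. real_of_int (z i) / (4 * sqrt (real r)))" for z :: "nat \<Rightarrow> int"
  have finZ: "finite Z" and cardZ: "real (card Z) \<le> (4 * 2 ^ 16) ^ r"
    unfolding Z_def by (rule card_int_ball_le)+
  show ?thesis
  proof
    show "finite (pt ` Z)" using finZ by simp
    show "pt ` Z \<subseteq> carrier_vec r" by (auto simp: pt_def)
    have "real (card (pt ` Z)) \<le> real (card Z)" using finZ by (simp add: card_image_le)
    then show "real (card (pt ` Z)) \<le> (2 ^ 18) ^ r" using cardZ by simp
    show "vnorm y \<le> 1" if y: "y \<in> pt ` Z" for y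
    proof -
      obtain z where z: "z \<in> Z" "y = pt z" using y by auto
      have "real_of_int (\<Sum>i<r. (z i)\<^sup>2) \<le> real_of_int (int (16 * r))"
        using z(1) unfolding Z_def of_int_le_iff by simp
      then have "(\<Sum>i<r. (real_of_int (z i))\<^sup>2) \<le> 16 * real r" by simp
      then have "(\<Sum>i<r. (real_of_int (z i))\<^sup>2) / (16 * real r) \<le> 1"
        using assms by (simp add: divide_simps)
      then show ?thesis
        unfolding vnorm_le_one_iff z(2)
        by (simp add: pt_def power_divide power_mult_distrib sum_divide_distrib)
    qed
    show "\<exists>y\<in>pt ` Z. vnorm (x - y) \<le> 1 / 4" if x: "x \<in> carrier_vec r" "vnorm x \<le> 1" for x
    proof -
      \<comment> \<open>Rounding towards 0 does not increase any coordinate in absolute value, so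
        the grid point stays in the unit ball.\<close>
      define z where "z = restrict (\<lambda>i. let y = 4 * sqrt (real r) * x $ i in
         if y \<ge> 0 then \<lfloor>y\<rfloor> else \<lceil>y\<rceil>) {..<r}"
      have z_abs: "\<bar>real_of_int (z i)\<bar> \<le> \<bar>4 * sqrt (real r) * x $ i\<bar>"
        and z_close: "\<bar>4 * sqrt (real r) * x $ i - real_of_int (z i)\<bar> \<le> 1" if "i < r" for i
        using that unfolding z_def restrict_def Let_def by (auto; linarith)+
      have "(\<Sum>i<r. (real_of_int (z i))\<^sup>2) \<le> (\<Sum>i<r. (4 * sqrt (real r) * x $ i)\<^sup>2)"
        using z_abs by (intro sum_mono) (auto simp: abs_le_square_iff)
      also have "\<dots> = 16 * real r * (\<Sum>i<r. (x $ i)\<^sup>2)"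
        by (simp add: power_mult_distrib sum_distrib_left)
      also have "\<dots> \<le> 16 * real r * 1"
        using x by (intro mult_left_mono) (auto simp: vnorm_le_one_iff)
      finally have "real_of_int (\<Sum>i<r. (z i)\<^sup>2) \<le> real_of_int (int (16 * r))" by simp
      then have "z \<in> Z" unfolding Z_def of_int_le_iff by (auto simp: z_def)
      have "(\<Sum>i<r. (x $ i - real_of_int (z i) / (4 * sqrt (real r)))\<^sup>2)
          = (\<Sum>i<r. (4 * sqrt (real r) * x $ i - real_of_int (z i))\<^sup>2) / (16 * real r)"
        unfolding sum_divide_distrib
      proof (rule sum.cong[OF refl])
        fix i
        have "x $ i - real_of_int (z i) / (4 * sqrt (real r))
          = (4 * sqrt (real r) * x $ i - real_of_int (z i)) / (4 * sqrt (real r))"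
          using assms by (simp add: field_simps)
        then show "(x $ i - real_of_int (z i) / (4 * sqrt (real r)))\<^sup>2
          = (4 * sqrt (real r) * x $ i - real_of_int (z i))\<^sup>2 / (16 * real r)"
          by (simp add: power_divide power_mult_distrib)
      qed
      also have "\<dots> \<le> (\<Sum>i<r. 1) / (16 * real r)"
        using z_close by (intro divide_right_mono sum_mono) (auto simp: abs_square_le_1)
      also have "\<dots> = (1 / 4)\<^sup>2" using assms by (simp add: power2_eq_square)
      finally have "sqrt (\<Sum>i<r. (x $ i - real_of_int (z i) / (4 * sqrt (real r)))\<^sup>2) \<le> 1 / 4"
        by (intro real_le_lsqrt) auto
      moreover have "vnorm (x - pt z)
          = sqrt (\<Sum>i<r. (x $ i - real_of_int (z i) / (4 * sqrt (real r)))\<^sup>2)"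
        using x(1) by (simp add: vnorm_def scalar_prod_def pt_def power2_eq_square atLeast0LessThan)
      ultimately show ?thesis using \<open>z \<in> Z\<close> by (intro bexI[of _ "pt z"]) auto
    qed
  qed
qed

text \<open>Let \<open>s\<close> be the supremum of the form over pairs in the unit ball. Replacing
  each argument by a net point costs at most \<open>s / 4\<close>, so
  \<open>s \<le> t + s / 2\<close> and \<open>s \<le> 2 * t\<close>; homogeneity extends this to all
  vectors.\<close>

lemma bilinear_le_of_net:
  assumes M: "M \<in> carrier_mat r r" and N: "N \<subseteq> carrier_vec r"
    and N1: "\<And>y. y \<in> N \<Longrightarrow> vnorm y \<le> 1"
    and net: "\<And>x. x \<in> carrier_vec r \<Longrightarrow> vnorm x \<le> 1 \<Longrightarrow> \<exists>y\<in>N. vnorm (x - y) \<le> 1 / 4"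
    and le: "\<And>x y. x \<in> N \<Longrightarrow> y \<in> N \<Longrightarrow> x \<bullet> (M *\<^sub>v y) \<le> t"
    and x: "x \<in> carrier_vec r" and y: "y \<in> carrier_vec r"
  shows "x \<bullet> (M *\<^sub>v y) \<le> 2 * t * (vnorm x * vnorm y)"
proof -
  define B where "B = {v \<in> carrier_vec r. vnorm v \<le> 1}"
  define S where "S = (\<lambda>(x, y). x \<bullet> (M *\<^sub>v y)) ` (B \<times> B)"
  define s where "s = Sup S"
  have "0\<^sub>v r \<in> B" by (simp add: B_def)
  then have ne: "S \<noteq> {}" by (auto simp: S_def)
  \<comment> \<open>The supremum must be finite before \<open>s / 2\<close> can be absorbed; the sum
    of the absolute entries is a sufficient crude bound.\<close>
  have bdd: "bdd_above S"
  proof (rule bdd_aboveI)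
    fix v assume "v \<in> S"
    then obtain x y where xy: "x \<in> B" "y \<in> B" "v = x \<bullet> (M *\<^sub>v y)" by (auto simp: S_def)
    have "v = (\<Sum>i\<in>{0..<r}. \<Sum>j\<in>{0..<r}. M $$ (i, j) * (x $ i * y $ j))"
      using xy M by (auto simp: B_def scalar_prod_def sum_distrib_left ac_simps)
    also have "\<dots> \<le> (\<Sum>i\<in>{0..<r}. \<Sum>j\<in>{0..<r}. \<bar>M $$ (i, j)\<bar>)"
    proof (intro sum_mono)
      fix i j assume ij: "i \<in> {0..<r}" "j \<in> {0..<r}"
      then have "\<bar>x $ i\<bar> \<le> 1" "\<bar>y $ j\<bar> \<le> 1"
        using xy abs_index_le_vnorm[of i x] abs_index_le_vnorm[of j y] by (auto simp: B_def)
      then have "\<bar>x $ i * y $ j\<bar> \<le> 1" unfolding abs_mult by (intro mult_le_one) auto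
      then have "\<bar>M $$ (i, j) * (x $ i * y $ j)\<bar> \<le> \<bar>M $$ (i, j)\<bar>"
        unfolding abs_mult[of "M $$ (i, j)"] by (simp add: mult_left_le)
      then show "M $$ (i, j) * (x $ i * y $ j) \<le> \<bar>M $$ (i, j)\<bar>" by linarith
    qed
    finally show "v \<le> (\<Sum>i\<in>{0..<r}. \<Sum>j\<in>{0..<r}. \<bar>M $$ (i, j)\<bar>)" .
  qed
  have le_s: "x \<bullet> (M *\<^sub>v y) \<le> s" if "x \<in> B" "y \<in> B" for x y
    unfolding s_def using that by (intro cSup_upper bdd) (auto simp: S_def)
  have half: "x \<bullet> (M *\<^sub>v y) \<le> t + s / 2" if xy: "x \<in> B" "y \<in> B" for x y
  proof -
    have c [simp]: "x \<in> carrier_vec r" "y \<in> carrier_vec r" using xy by (auto simp: B_def)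
    obtain x0 where x0: "x0 \<in> N" "vnorm (x - x0) \<le> 1 / 4" using net[of x] xy by (auto simp: B_def)
    obtain y0 where y0: "y0 \<in> N" "vnorm (y - y0) \<le> 1 / 4" using net[of y] xy by (auto simp: B_def)
    have c0 [simp]: "x0 \<in> carrier_vec r" "y0 \<in> carrier_vec r" using x0 y0 N by auto
    have Mc [simp]: "M *\<^sub>v v \<in> carrier_vec r" if "v \<in> carrier_vec r" for v using M that by simp
    have x0B: "x0 \<in> B" using x0 N1 by (simp add: B_def)
    \<comment> \<open>The differences have norm at most 1/4, so scaled by 4 they return to the unit
      ball, where the form is at most \<open>s\<close>.\<close>
    have "4 \<cdot>\<^sub>v (y - y0) \<in> B" "4 \<cdot>\<^sub>v (x - x0) \<in> B"
      using x0 y0 by (simp_all add: B_def vnorm_smult)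
    then have "x0 \<bullet> (M *\<^sub>v (4 \<cdot>\<^sub>v (y - y0))) \<le> s" "(4 \<cdot>\<^sub>v (x - x0)) \<bullet> (M *\<^sub>v y) \<le> s"
      using le_s x0B xy by auto
    then have "4 * (x0 \<bullet> (M *\<^sub>v y) - x0 \<bullet> (M *\<^sub>v y0)) \<le> s"
      "4 * (x \<bullet> (M *\<^sub>v y) - x0 \<bullet> (M *\<^sub>v y)) \<le> s"
      using M by (simp_all add: mult_mat_vec[of _ r r] mult_minus_distrib_mat_vec[of _ r r]
          scalar_prod_minus_distrib[of _ r] minus_scalar_prod_distrib[of _ r])
    then show ?thesis using le[OF x0(1) y0(1)] by simp
  qed
  have "s \<le> t + s / 2" unfolding s_def
    by (rule cSup_least[OF ne]) (use half in \<open>auto simp: S_def s_def\<close>)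
  then have s: "s \<le> 2 * t" by simp
  show ?thesis
  proof (cases "vnorm x = 0 \<or> vnorm y = 0")
    case True
    then have "x = 0\<^sub>v r \<or> y = 0\<^sub>v r" using x y vnorm_eq_0_imp by blast
    then show ?thesis using x y M by (auto simp: mult_mat_vec_def scalar_prod_def)
  next
    case False
    then have pos: "vnorm x > 0" "vnorm y > 0"
      using vnorm_nonneg[of x] vnorm_nonneg[of y] by linarith+
    have "(inverse (vnorm x) \<cdot>\<^sub>v x) \<bullet> (M *\<^sub>v (inverse (vnorm y) \<cdot>\<^sub>v y)) \<le> s"
      using pos x y by (intro le_s) (auto simp: B_def vnorm_smult)
    then have "inverse (vnorm y) * (inverse (vnorm x) * (x \<bullet> (M *\<^sub>v y))) \<le> 2 * t"
      using s M x y by (simp add: mult_mat_vec[of _ r r])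
    then show ?thesis using pos by (simp add: field_simps)
  qed
qed

section \<open>Concentration for compressions of the Bernoulli matrix\<close>

lemma vnorm_isometry:
  assumes "U \<in> carrier_mat n r" "U\<^sup>T * U = 1\<^sub>m r" "x \<in> carrier_vec r"
  shows "vnorm (U *\<^sub>v x) = vnorm x"
proof -
  have "(U *\<^sub>v x) \<bullet> (U *\<^sub>v x) = (U\<^sup>T *\<^sub>v (U *\<^sub>v x)) \<bullet> x"
    using assms by (simp add: scalar_prod_mult_mat_vec[of U n r])
  also have "U\<^sup>T *\<^sub>v (U *\<^sub>v x) = x"
    using assms by (simp add: assoc_mult_mat_vec[symmetric, of _ r n _ r])
  finally show ?thesis by (simp add: vnorm_def)
qed

text \<open>The form is a Rademacher sum over index pairs with coefficients
  \<open>a $ i * b $ j\<close>, whose squares add up to the product of the squared norms.\<close>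

lemma bernoulli_bilinear_tail:
  assumes a: "a \<in> carrier_vec n" "vnorm a \<le> 1" and b: "b \<in> carrier_vec n" "vnorm b \<le> 1" and t: "t > 0"
  shows "measure_pmf.prob (bernoulli_matrix_pmf n) {E. t \<le> a \<bullet> (E *\<^sub>v b)} \<le> exp (- t\<^sup>2 / 2)"
proof -
  have "(\<Sum>(i, j)\<in>{..<n} \<times> {..<n}. (a $ i * b $ j)\<^sup>2) = (\<Sum>i<n. (a $ i)\<^sup>2) * (\<Sum>j<n. (b $ j)\<^sup>2)"
    by (simp add: sum.cartesian_product[symmetric] sum_product power_mult_distrib)
  also have "\<dots> \<le> 1"
    using a b by (intro mult_le_one) (auto simp: vnorm_le_one_iff intro!: sum_nonneg)
  finally have coeffs: "(\<Sum>k\<in>{..<n} \<times> {..<n}. (a $ fst k * b $ snd k)\<^sup>2) \<le> 1"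
    by (simp add: case_prod_unfold)
  have form: "a \<bullet> (mat n n e *\<^sub>v b) = (\<Sum>k\<in>{..<n} \<times> {..<n}. a $ fst k * b $ snd k * e k)"
    for e :: "nat \<times> nat \<Rightarrow> real"
    using a b by (simp add: scalar_prod_def sum_distrib_left atLeast0LessThan
        sum.cartesian_product case_prod_unfold ac_simps)
  show ?thesis
    unfolding bernoulli_matrix_pmf_def measure_map_pmf vimage_def mem_Collect_eq form
    by (rule rademacher_tail[OF _ coeffs t]) simp
qed

text \<open>Union bound over pairs of net points: \<open>(2 ^ 18) ^ (2 * r)\<close> events, each of
  probability at most \<open>exp (- K\<^sup>2 / 8) ^ r\<close>. Both factors are \<open>r\<close>-th
  powers, so one \<open>K\<close> serves all \<open>n\<close>, \<open>r\<close>, \<open>U\<close>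
  and \<open>V\<close>. The one-sided inequality also bounds the absolute value, as \<open>x\<close>
  may be negated.\<close>

lemma bernoulli_compression_bound:
  fixes \<epsilon> :: real
  assumes "\<epsilon> > 0"
  obtains K where "K > 0"
    "\<And>n r U V. r > 0 \<Longrightarrow> U \<in> carrier_mat n r \<Longrightarrow> V \<in> carrier_mat n r \<Longrightarrow>
      U\<^sup>T * U = 1\<^sub>m r \<Longrightarrow> V\<^sup>T * V = 1\<^sub>m r \<Longrightarrow>
      measure_pmf.prob (bernoulli_matrix_pmf n)
        {E. \<not> (\<forall>x\<in>carrier_vec r. \<forall>y\<in>carrier_vec r.
          (U *\<^sub>v x) \<bullet> (E *\<^sub>v (V *\<^sub>v y)) \<le> K * sqrt (real r) * (vnorm x * vnorm y))} \<le> \<epsilon>"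
proof -
  \<comment> \<open>The cap at 1 ensures \<open>\<eta> ^ r \<le> \<eta>\<close> for
    \<open>r > 0\<close>.\<close>
  define \<eta> where "\<eta> = min 1 \<epsilon>"
  have \<eta>: "\<eta> > 0" "\<eta> \<le> 1" "\<eta> \<le> \<epsilon>" using assms by (auto simp: \<eta>_def)
  \<comment> \<open>Because \<open>K \<ge> 1\<close>, a bound linear in \<open>K\<close> suffices:
    \<open>K\<^sup>2 / 8 \<ge> K / 8\<close>, which dominates the logarithm.\<close>
  define K where "K = 1 + 8 * \<bar>ln (2 ^ 36 / \<eta>)\<bar>"
  have K: "K \<ge> 1" by (simp add: K_def)
  have "ln (2 ^ 36 / \<eta>) \<le> K / 8" unfolding K_def by (simp add: field_simps)
  also have "K / 8 \<le> K\<^sup>2 / 8" using K by (simp add: power2_eq_square)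
  finally have "exp (ln (2 ^ 36 / \<eta>)) \<le> exp (K\<^sup>2 / 8)" by (simp only: exp_le_cancel_iff)
  moreover have "exp (ln (2 ^ 36 / \<eta>)) = 2 ^ 36 / \<eta>" using \<eta> by (intro exp_ln) simp
  ultimately have "2 ^ 36 / \<eta> \<le> exp (K\<^sup>2 / 8)" by (simp only:)
  then have base: "2 ^ 36 * exp (- K\<^sup>2 / 8) \<le> \<eta>" using \<eta> by (simp add: exp_minus field_simps)
  show ?thesis
  proof
    show "K > 0" using K by simp
    fix n r :: nat and U V :: "real mat"
    assume r: "r > 0" and U: "U \<in> carrier_mat n r" "U\<^sup>T * U = 1\<^sub>m r"
      and V: "V \<in> carrier_mat n r" "V\<^sup>T * V = 1\<^sub>m r"
    let ?p = "bernoulli_matrix_pmf n"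
    let ?bad = "{E. \<not> (\<forall>x\<in>carrier_vec r. \<forall>y\<in>carrier_vec r.
          (U *\<^sub>v x) \<bullet> (E *\<^sub>v (V *\<^sub>v y)) \<le> K * sqrt (real r) * (vnorm x * vnorm y))}"
    obtain N where N: "finite N" "N \<subseteq> carrier_vec r" "real (card N) \<le> (2 ^ 18) ^ r"
      "\<And>y. y \<in> N \<Longrightarrow> vnorm y \<le> 1"
      "\<And>x. x \<in> carrier_vec r \<Longrightarrow> vnorm x \<le> 1 \<Longrightarrow> \<exists>y\<in>N. vnorm (x - y) \<le> 1 / 4"
      using ball_net_exists[OF r] by blast
    \<comment> \<open>Half of the target, since passing from the net to the ball doubles the
      bound.\<close>
    define t where "t = K * sqrt (real r) / 2"
    have t: "t > 0" using K r by (simp add: t_def)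
    let ?tail = "\<lambda>(x, y). {E. t \<le> (U *\<^sub>v x) \<bullet> (E *\<^sub>v (V *\<^sub>v y))}"
    have carr: "E \<in> carrier_mat n n" if "E \<in> set_pmf ?p" for E
      using that by (auto simp: bernoulli_matrix_pmf_def)
    \<comment> \<open>Only matrices in the support are known to have dimensions \<open>n\<close> by
      \<open>n\<close>, so the inclusion is restricted to it.\<close>
    have "?bad \<inter> set_pmf ?p \<subseteq> (\<Union>xy\<in>N \<times> N. ?tail xy)"
    proof (rule subsetI, rule ccontr)
      fix E assume E: "E \<in> ?bad \<inter> set_pmf ?p" and no: "E \<notin> (\<Union>xy\<in>N \<times> N. ?tail xy)"
      have Ec: "E \<in> carrier_mat n n" using E carr by simp
      define M where "M = U\<^sup>T * (E * V)"
      have M: "M \<in> carrier_mat r r" using U V Ec by (simp add: M_def)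
      have form: "x \<bullet> (M *\<^sub>v y) = (U *\<^sub>v x) \<bullet> (E *\<^sub>v (V *\<^sub>v y))"
        if "x \<in> carrier_vec r" "y \<in> carrier_vec r" for x y
      proof -
        have "M *\<^sub>v y = U\<^sup>T *\<^sub>v (E *\<^sub>v (V *\<^sub>v y))"
          unfolding M_def using U V Ec that
          by (simp add: assoc_mult_mat_vec[of _ r n _ r] assoc_mult_mat_vec[of _ n n _ r])
        then show ?thesis using U V Ec that
          by (simp add: scalar_prod_mult_mat_vec[of "U\<^sup>T" r n])
      qed
      have "x \<bullet> (M *\<^sub>v y) \<le> t" if "x \<in> N" "y \<in> N" for x y
        using no that N(2) by (subst form) (auto simp: not_le intro: less_imp_le)
      then have "x \<bullet> (M *\<^sub>v y) \<le> 2 * t * (vnorm x * vnorm y)"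
        if "x \<in> carrier_vec r" "y \<in> carrier_vec r" for x y
        using bilinear_le_of_net[OF M N(2,4,5)] that by blast
      then show False using E form by (auto simp: t_def)
    qed
    then have "measure_pmf.prob ?p (?bad \<inter> set_pmf ?p) \<le> measure_pmf.prob ?p (\<Union>xy\<in>N \<times> N. ?tail xy)"
      by (intro measure_pmf.finite_measure_mono) auto
    also have "\<dots> \<le> (\<Sum>xy\<in>N \<times> N. measure_pmf.prob ?p (?tail xy))"
      using N(1) by (intro measure_pmf.finite_measure_subadditive_finite) auto
    also have "\<dots> \<le> (\<Sum>xy\<in>N \<times> N. exp (- t\<^sup>2 / 2))"
    proof (rule sum_mono)
      fix xy assume "xy \<in> N \<times> N"
      then obtain x y where xy: "xy = (x, y)" "x \<in> N" "y \<in> N" by auto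
      then have c: "x \<in> carrier_vec r" "y \<in> carrier_vec r" using N(2) by auto
      show "measure_pmf.prob ?p (?tail xy) \<le> exp (- t\<^sup>2 / 2)"
        unfolding xy(1) case_prod_conv
        using xy c U V N(4) vnorm_isometry[OF U c(1)] vnorm_isometry[OF V c(2)]
        by (intro bernoulli_bilinear_tail t) auto
    qed
    also have "\<dots> = real (card N) * real (card N) * exp (- t\<^sup>2 / 2)"
      by (simp add: card_cartesian_product)
    also have "\<dots> \<le> (2 ^ 18) ^ r * (2 ^ 18) ^ r * exp (- t\<^sup>2 / 2)"
      using N(3) by (intro mult_right_mono mult_mono) auto
    also have "exp (- t\<^sup>2 / 2) = exp (- K\<^sup>2 / 8) ^ r"
      by (simp add: t_def exp_of_nat_mult[symmetric] power_divide power_mult_distrib)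
    also have "(2 ^ 18) ^ r * (2 ^ 18) ^ r * exp (- K\<^sup>2 / 8) ^ r = (2 ^ 36 * exp (- K\<^sup>2 / 8)) ^ r"
      unfolding power_mult_distrib[symmetric] by simp
    also have "\<dots> \<le> \<eta> ^ r" using base by (intro power_mono) auto
    also have "\<dots> \<le> \<eta>" using power_decreasing[of 1 r \<eta>] \<eta> r by simp
    also have "\<dots> \<le> \<epsilon>" by fact
    finally show "measure_pmf.prob ?p ?bad \<le> \<epsilon>" by (simp add: measure_Int_set_pmf)
  qed
qed

section \<open>Diagonalization of real symmetric matrices\<close>

lemma orthonormal_iff_scalar_prod:
  assumes "Q \<in> carrier_mat n r"
  shows "Q\<^sup>T * Q = 1\<^sub>m r \<longleftrightarrow>
    (\<forall>i<r. \<forall>j<r. col Q i \<bullet> col Q j = (if i = j then 1 else (0::real)))"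
proof
  assume eq: "Q\<^sup>T * Q = 1\<^sub>m r"
  show "\<forall>i<r. \<forall>j<r. col Q i \<bullet> col Q j = (if i = j then 1 else 0)"
  proof (intro allI impI)
    fix i j assume "i < r" "j < r"
    then show "col Q i \<bullet> col Q j = (if i = j then 1 else 0)"
      using arg_cong[OF eq, of "\<lambda>M. M $$ (i, j)"] assms by simp
  qed
next
  assume "\<forall>i<r. \<forall>j<r. col Q i \<bullet> col Q j = (if i = j then 1 else 0)"
  then show "Q\<^sup>T * Q = 1\<^sub>m r" by (intro eq_matI) (use assms in simp_all)
qed

text \<open>The complexified matrix has an eigenvector \<open>x + i y\<close> with eigenvalue
  \<open>k\<close>. Symmetry, in the form \<open>x \<bullet> S y = S x \<bullet> y\<close>, forces
  \<open>Im k * (|x|\<^sup>2 + |y|\<^sup>2) = 0\<close>; hence \<open>k\<close> is real and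
  whichever of \<open>x\<close>, \<open>y\<close> is nonzero is a real eigenvector.\<close>

lemma real_symmetric_eigenvector_exists:
  assumes S: "S \<in> carrier_mat n n" "S\<^sup>T = S" and n: "n > 0"
  obtains v k where "v \<in> carrier_vec n" "v \<noteq> 0\<^sub>v n" "S *\<^sub>v v = (k::real) \<cdot>\<^sub>v v"
proof -
  define C where "C = map_mat complex_of_real S"
  have C: "C \<in> carrier_mat n n" using S by (simp add: C_def)
  obtain k v where v: "v \<in> carrier_vec n" "v \<noteq> 0\<^sub>v n" "C *\<^sub>v v = k \<cdot>\<^sub>v v"
    using spectrum_non_empty[OF C n] C
    by (auto simp: spectrum_def eigenvalue_def eigenvector_def)
  define x where "x = map_vec Re v"
  define y where "y = map_vec Im v"
  have xy [simp]: "x \<in> carrier_vec n" "y \<in> carrier_vec n" using v by (simp_all add: x_def y_def)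
  have comp: "(\<Sum>j\<in>{0..<n}. complex_of_real (S $$ (i, j)) * v $ j) = k * v $ i" if "i < n" for i
    using arg_cong[OF v(3), of "\<lambda>w. w $ i"] that v(1) S(1)
    by (simp add: C_def scalar_prod_def)
  have Sx: "S *\<^sub>v x = Re k \<cdot>\<^sub>v x - Im k \<cdot>\<^sub>v y"
  proof (rule eq_vecI)
    fix i assume "i < dim_vec (Re k \<cdot>\<^sub>v x - Im k \<cdot>\<^sub>v y)"
    then have i: "i < n" using v(1) by (simp add: y_def)
    show "(S *\<^sub>v x) $ i = (Re k \<cdot>\<^sub>v x - Im k \<cdot>\<^sub>v y) $ i"
      using arg_cong[OF comp[OF i], of Re] i v(1) S(1) by (simp add: scalar_prod_def x_def y_def)
  qed (use S v(1) in \<open>simp add: y_def\<close>)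
  have Sy: "S *\<^sub>v y = Im k \<cdot>\<^sub>v x + Re k \<cdot>\<^sub>v y"
  proof (rule eq_vecI)
    fix i assume "i < dim_vec (Im k \<cdot>\<^sub>v x + Re k \<cdot>\<^sub>v y)"
    then have i: "i < n" using v(1) by (simp add: y_def)
    show "(S *\<^sub>v y) $ i = (Im k \<cdot>\<^sub>v x + Re k \<cdot>\<^sub>v y) $ i"
      using arg_cong[OF comp[OF i], of Im] i v(1) S(1) by (simp add: scalar_prod_def x_def y_def algebra_simps)
  qed (use S v(1) in \<open>simp add: y_def\<close>)
  have "x \<noteq> 0\<^sub>v n \<or> y \<noteq> 0\<^sub>v n"
  proof (rule ccontr)
    assume "\<not> (x \<noteq> 0\<^sub>v n \<or> y \<noteq> 0\<^sub>v n)"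
    then have "Re (v $ i) = 0" "Im (v $ i) = 0" if "i < n" for i
      using that v(1) index_map_vec(1)[of i v Re] index_map_vec(1)[of i v Im]
      by (auto simp: x_def y_def)
    then have "v = 0\<^sub>v n" using v(1) by (intro eq_vecI) (auto simp: complex_eq_iff)
    then show False using v(2) by simp
  qed
  then have "vnorm x \<noteq> 0 \<or> vnorm y \<noteq> 0" using vnorm_eq_0_imp[OF xy(1)] vnorm_eq_0_imp[OF xy(2)] by blast
  then have pos: "x \<bullet> x + y \<bullet> y \<noteq> 0" unfolding vnorm_square[symmetric] sum_power2_eq_zero_iff by simp
  have "x \<bullet> (S *\<^sub>v y) = (S *\<^sub>v x) \<bullet> y" using scalar_prod_mult_mat_vec[OF S(1) xy] S(2) by simp
  then have "Im k * (x \<bullet> x + y \<bullet> y) = 0" unfolding Sx Sy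
    by (simp add: scalar_prod_add_distrib[of _ n] minus_scalar_prod_distrib[of _ n]
        smult_scalar_prod_distrib[of _ n] scalar_prod_smult_distrib[of _ n] comm_scalar_prod[of x n y] algebra_simps)
  then have k: "Im k = 0" using pos by simp
  note dims = carrier_vecD[OF xy(1)] carrier_vecD[OF xy(2)]
  have "S *\<^sub>v x = Re k \<cdot>\<^sub>v x" unfolding Sx k by (rule eq_vecI) (simp_all add: dims)
  moreover have "S *\<^sub>v y = Re k \<cdot>\<^sub>v y" unfolding Sy k by (rule eq_vecI) (simp_all add: dims)
  ultimately show ?thesis using that[of x "Re k"] that[of y "Re k"] \<open>x \<noteq> 0\<^sub>v n \<or> y \<noteq> 0\<^sub>v n\<close> by auto
qed

text \<open>Gram-Schmidt applied to a basis that starts with \<open>v\<close> keeps its first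
  vector, and normalising the columns only rescales it.\<close>

lemma orthogonal_mat_with_first_col:
  assumes v: "v \<in> carrier_vec n" "v \<noteq> 0\<^sub>v n" and n: "n > 0"
  obtains W :: "real mat" and c where "W \<in> carrier_mat n n" "W\<^sup>T * W = 1\<^sub>m n" "col W 0 = c \<cdot>\<^sub>v v"
proof -
  interpret gs: vec_space "TYPE(real)" n .
  interpret cof_vec_space n "TYPE(real)" .
  note bc = gs.basis_completion[OF v]
  define ws where "ws = gram_schmidt n (basis_completion v)"
  have ws: "corthogonal ws" "set ws \<subseteq> carrier_vec n" "length ws = n"
    using gram_schmidt_result[OF bc(2,4,5) ws_def] bc(6) by auto
  have "basis_completion v = v # tl (basis_completion v)"
    using bc(6,7) n by (metis length_greater_0_conv list.collapse)
  then have hd: "ws ! 0 = v" unfolding ws_def using gram_schmidt_hd[OF v(1)] ws(3) n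
    by (metis hd_conv_nth length_greater_0_conv ws_def)
  define W where "W = mat_of_cols n (map (\<lambda>w. inverse (vnorm w) \<cdot>\<^sub>v w) ws)"
  have W: "W \<in> carrier_mat n n" using ws by (simp add: W_def mat_of_cols_def)
  have wc: "ws ! i \<in> carrier_vec n" if "i < n" for i using ws that by auto
  have col: "col W i = inverse (vnorm (ws ! i)) \<cdot>\<^sub>v ws ! i" if "i < n" for i
    unfolding W_def using ws that wc by (subst col_mat_of_cols) auto
  have orth: "ws ! i \<bullet> ws ! j = 0 \<longleftrightarrow> i \<noteq> j" if "i < n" "j < n" for i j
    using corthogonalD[OF ws(1), of i j] that ws by simp
  have "col W i \<bullet> col W j = (if i = j then 1 else 0)" if "i < n" "j < n" for i j
  proof -
    have "vnorm (ws ! i) \<noteq> 0" using orth[of i i] that by (simp add: vnorm_def)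
    then show ?thesis
      using wc[OF that(1)] wc[OF that(2)] orth[OF that] unfolding col[OF that(1)] col[OF that(2)]
      by (cases "i = j") (simp_all add: vnorm_mult_self[symmetric] vnorm_smult)
  qed
  then have "W\<^sup>T * W = 1\<^sub>m n" using orthonormal_iff_scalar_prod[OF W] by blast
  then show ?thesis using that[OF W _ col[OF n, unfolded hd]] by blast
qed

text \<open>Induction on the dimension: in an orthonormal basis starting with an eigenvector, the
  first column is zero off the diagonal and by symmetry so is the first row. The remaining block is
  symmetric and of smaller size.\<close>

theorem real_symmetric_diagonalization:
  assumes "S \<in> carrier_mat n n" "S\<^sup>T = (S :: real mat)"
  shows "\<exists>Q D. Q \<in> carrier_mat n n \<and> D \<in> carrier_mat n n \<and> diagonal_mat D \<and>
    Q\<^sup>T * Q = 1\<^sub>m n \<and> S = Q * D * Q\<^sup>T"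
  using assms
proof (induction n arbitrary: S)
  case 0
  then show ?case by (intro exI[of _ "0\<^sub>m 0 0"]) (auto simp: diagonal_mat_def)
next
  case (Suc m S)
  let ?n = "Suc m"
  note S = Suc.prems
  obtain v k where v: "v \<in> carrier_vec ?n" "v \<noteq> 0\<^sub>v ?n" "S *\<^sub>v v = k \<cdot>\<^sub>v v"
    using real_symmetric_eigenvector_exists[OF S] by blast
  obtain W c where W: "W \<in> carrier_mat ?n ?n" "W\<^sup>T * W = 1\<^sub>m ?n" "col W 0 = c \<cdot>\<^sub>v v"
    using orthogonal_mat_with_first_col[OF v(1,2)] by blast
  have WW: "W * W\<^sup>T = 1\<^sub>m ?n" using mat_mult_left_right_inverse[of "W\<^sup>T" ?n W] W by simp
  define T where "T = W\<^sup>T * (S * W)"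
  have T: "T \<in> carrier_mat ?n ?n" using S W by (simp add: T_def)
  have "T\<^sup>T = (S * W)\<^sup>T * W\<^sup>T\<^sup>T" unfolding T_def
    by (rule transpose_mult[of _ ?n ?n _ ?n]) (use S W in auto)
  also have "(S * W)\<^sup>T = W\<^sup>T * S" using transpose_mult[OF S(1) W(1)] S(2) by simp
  also have "W\<^sup>T * S * W\<^sup>T\<^sup>T = T" unfolding T_def using S W by (simp add: assoc_mult_mat[of _ ?n ?n _ ?n _ ?n])
  finally have Tsym: "T\<^sup>T = T" .
  have T0: "T $$ (i, 0) = (if i = 0 then k else 0)" if i: "i < ?n" for i
  proof -
    have "T $$ (i, 0) = col W i \<bullet> (S *\<^sub>v col W 0)"
      unfolding T_def using i W(1) S(1) by (simp add: mult_mat_vec_def)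
    also have "S *\<^sub>v col W 0 = k \<cdot>\<^sub>v col W 0"
      unfolding W(3) using S(1) v by (simp add: mult_mat_vec[of _ ?n ?n] smult_smult_assoc ac_simps)
    also have "col W i \<bullet> (k \<cdot>\<^sub>v col W 0) = (if i = 0 then k else 0)"
      using W(1,2) i orthonormal_iff_scalar_prod[OF W(1)] by (auto simp: scalar_prod_smult_distrib[of _ ?n])
    finally show ?thesis .
  qed
  have T0': "T $$ (0, i) = (if i = 0 then k else 0)" if i: "i < ?n" for i
    using T0[OF i] i T index_transpose_mat(1)[of i T 0] unfolding Tsym by auto
  define T' where "T' = mat m m (\<lambda>(i, j). T $$ (Suc i, Suc j))"
  have T': "T' \<in> carrier_mat m m" by (simp add: T'_def)
  have "T'\<^sup>T = T'"
  proof (rule eq_matI)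
    fix i j assume "i < dim_row T'" "j < dim_col T'"
    then show "T'\<^sup>T $$ (i, j) = T' $$ (i, j)"
      using T index_transpose_mat(1)[of "Suc i" T "Suc j"] unfolding Tsym by (auto simp: T'_def)
  qed (auto simp: T'_def)
  then obtain Q' D' where Q': "Q' \<in> carrier_mat m m" "Q'\<^sup>T * Q' = 1\<^sub>m m"
    and D': "D' \<in> carrier_mat m m" "diagonal_mat D'" and eq: "T' = Q' * D' * Q'\<^sup>T"
    using Suc.IH[OF T'] by blast
  define k1 where "k1 = mat 1 1 (\<lambda>_. k)"
  have k1: "k1 \<in> carrier_mat 1 1" by (simp add: k1_def)
  have Tblock: "T = four_block_mat k1 (0\<^sub>m 1 m) (0\<^sub>m m 1) T'"
    by (rule eq_matI) (use T T0 T0' in \<open>auto simp: k1_def T'_def\<close>)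
  \<comment> \<open>The rotation of the smaller block is extended by the identity on the eigenvector
    that was split off.\<close>
  define R where "R = four_block_mat (1\<^sub>m 1) (0\<^sub>m 1 m) (0\<^sub>m m 1) Q'"
  define D where "D = four_block_mat k1 (0\<^sub>m 1 m) (0\<^sub>m m 1) D'"
  have R: "R \<in> carrier_mat ?n ?n" using Q' by (auto simp: R_def)
  have D: "D \<in> carrier_mat ?n ?n" using D' k1 by (auto simp: D_def)
  have Dd: "diagonal_mat D" using D'(1,2) by (auto simp: diagonal_mat_def D_def k1_def)
  have Rt: "R\<^sup>T = four_block_mat (1\<^sub>m 1) (0\<^sub>m 1 m) (0\<^sub>m m 1) Q'\<^sup>T"
    unfolding R_def using Q' by (subst transpose_four_block_mat[of _ 1 1 _ m _ m]) auto
  have one: "four_block_mat (1\<^sub>m 1) (0\<^sub>m 1 m) (0\<^sub>m m 1) (1\<^sub>m m) = (1\<^sub>m ?n :: real mat)"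
    by (rule eq_matI) auto
  have RR: "R\<^sup>T * R = 1\<^sub>m ?n" unfolding Rt unfolding R_def
    using Q' one by (subst mult_four_block_mat[of _ 1 1 _ m _ m]) auto
  have TRD: "T = R * D * R\<^sup>T"
    unfolding Tblock Rt unfolding R_def D_def
    using Q' D' k1 eq
    by (subst mult_four_block_mat[of _ 1 1 _ m _ m]; (subst mult_four_block_mat[of _ 1 1 _ m _ m])?) auto
  define Q where "Q = W * R"
  have Q: "Q \<in> carrier_mat ?n ?n" using W R by (simp add: Q_def)
  have Qt: "Q\<^sup>T = R\<^sup>T * W\<^sup>T" unfolding Q_def by (rule transpose_mult[OF W(1) R])
  note assoc = assoc_mult_mat[of _ ?n ?n _ ?n _ ?n]
  have "Q\<^sup>T * Q = R\<^sup>T * (W\<^sup>T * W) * R" unfolding Qt unfolding Q_def using W(1) R by (simp add: assoc)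
  also have "\<dots> = 1\<^sub>m ?n" unfolding W(2) using R RR by simp
  finally have QQ: "Q\<^sup>T * Q = 1\<^sub>m ?n" .
  have "Q * D * Q\<^sup>T = W * (R * D * R\<^sup>T) * W\<^sup>T" unfolding Qt unfolding Q_def using W(1) R D by (simp add: assoc)
  also have "\<dots> = (W * W\<^sup>T) * S * (W * W\<^sup>T)" unfolding TRD[symmetric] T_def using W(1) S(1) by (simp add: assoc)
  also have "\<dots> = S" unfolding WW using S by simp
  finally have "S = Q * D * Q\<^sup>T" by simp
  then show ?case using Q D Dd QQ by blast
qed

section \<open>Singular values and singular bases\<close>

text \<open>Parseval's identity, from \<open>Q * Q\<^sup>T = 1\<close>.\<close>

lemma scalar_prod_orthonormal_basis:
  assumes Q: "Q \<in> carrier_mat n n" "Q\<^sup>T * Q = 1\<^sub>m n"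
    and x: "x \<in> carrier_vec n" and y: "y \<in> carrier_vec n"
  shows "x \<bullet> y = (\<Sum>i<n. (col Q i \<bullet> x) * (col Q i \<bullet> (y :: real Matrix.vec)))"
proof -
  have QQ: "Q * Q\<^sup>T = 1\<^sub>m n" using mat_mult_left_right_inverse[of "Q\<^sup>T" n Q] Q by simp
  have "Q *\<^sub>v (Q\<^sup>T *\<^sub>v y) = y"
    using assoc_mult_mat_vec[of Q n n "Q\<^sup>T" n y] Q(1) y QQ by simp
  then have "x \<bullet> y = (Q\<^sup>T *\<^sub>v x) \<bullet> (Q\<^sup>T *\<^sub>v y)"
    using scalar_prod_mult_mat_vec[of Q n n x "Q\<^sup>T *\<^sub>v y"] Q(1) x y by simp
  also have "\<dots> = (\<Sum>i<n. (col Q i \<bullet> x) * (col Q i \<bullet> y))"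
    using Q(1) by (simp add: scalar_prod_def[of "Q\<^sup>T *\<^sub>v x"] atLeast0LessThan)
  finally show ?thesis .
qed

lemma mult_mat_unit_vec:
  assumes "A \<in> carrier_mat n m" "i < m"
  shows "A *\<^sub>v unit_vec m i = col (A :: real mat) i"
  by (rule eq_vecI) (use assms in auto)

lemma proots_prod_linear_factors: "proots (\<Prod>e\<leftarrow>es. [:- e, 1:]) = mset (es :: real list)"
proof (induction es)
  case (Cons e es)
  have "(\<Prod>e\<leftarrow>es. [:- e, 1:]) \<noteq> 0" by (auto simp: prod_list_zero_iff)
  then show ?case using Cons by (simp add: proots_mult del: mult_pCons_left)
qed simp

text \<open>The columns of \<open>Q\<close> are right singular vectors and \<open>s i\<close> the singular values, in no particular
  order; \<open>m\<close> is the position of the largest one.\<close>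

lemma right_singular_basis_exists:
  assumes A: "A \<in> carrier_mat n n" and n: "n > 0"
  obtains Q s m where "Q \<in> carrier_mat n n" "Q\<^sup>T * Q = 1\<^sub>m n"
    "\<And>i. 0 \<le> s i"
    "\<And>i. i < n \<Longrightarrow> A\<^sup>T *\<^sub>v (A *\<^sub>v col Q i) = (s i)\<^sup>2 \<cdot>\<^sub>v col Q i"
    "m < n" "singular_value A 1 = s m" "\<And>i. i < n \<Longrightarrow> s i \<le> s m"
    "\<And>i. i < n \<Longrightarrow> i \<noteq> m \<Longrightarrow> s i \<le> singular_value A 2" "0 \<le> singular_value A 2"
proof -
  have S: "A\<^sup>T * A \<in> carrier_mat n n" using A by simp
  have Sym: "(A\<^sup>T * A)\<^sup>T = A\<^sup>T * A" using transpose_mult[of "A\<^sup>T" n n A n] A by simp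
  obtain Q D where Q: "Q \<in> carrier_mat n n" "Q\<^sup>T * Q = 1\<^sub>m n" and D: "D \<in> carrier_mat n n" "diagonal_mat D"
    and eq: "A\<^sup>T * A = Q * D * Q\<^sup>T"
    using real_symmetric_diagonalization[OF S Sym] by blast
  have QQ: "Q * Q\<^sup>T = 1\<^sub>m n" using mat_mult_left_right_inverse[of "Q\<^sup>T" n Q] Q by simp
  define d where "d i = D $$ (i, i)" for i
  define s where "s i = sqrt (d i)" for i
  have qc: "col Q i \<in> carrier_vec n" for i using Q(1) by (simp add: carrier_vecI)
  have eig: "A\<^sup>T *\<^sub>v (A *\<^sub>v col Q i) = d i \<cdot>\<^sub>v col Q i" if i: "i < n" for i
  proof -
    have 1: "A\<^sup>T *\<^sub>v (A *\<^sub>v col Q i) = Q * D * Q\<^sup>T *\<^sub>v col Q i"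
      unfolding eq[symmetric] using A qc by (simp add: assoc_mult_mat_vec[of _ n n _ n])
    have "Q * D * Q\<^sup>T *\<^sub>v col Q i = Q *\<^sub>v (D *\<^sub>v (Q\<^sup>T *\<^sub>v col Q i))"
      using Q(1) D(1) qc by (simp add: assoc_mult_mat_vec[of _ n n _ n])
    also have "Q\<^sup>T *\<^sub>v col Q i = unit_vec n i"
      by (rule eq_vecI) (use i Q(1) orthonormal_iff_scalar_prod[OF Q(1)] Q(2) in \<open>auto simp: unit_vec_def\<close>)
    also have "D *\<^sub>v unit_vec n i = d i \<cdot>\<^sub>v unit_vec n i"
      unfolding mult_mat_unit_vec[OF D(1) i]
      by (rule eq_vecI) (use i D in \<open>auto simp: d_def diagonal_mat_def unit_vec_def\<close>)
    also have "Q *\<^sub>v (d i \<cdot>\<^sub>v unit_vec n i) = d i \<cdot>\<^sub>v col Q i"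
      using i Q(1) by (simp add: mult_mat_vec[of _ n n] mult_mat_unit_vec)
    finally show ?thesis using 1 by simp
  qed
  \<comment> \<open>The diagonal entries are squared norms, hence nonnegative, so that squaring
    \<open>s i = sqrt (d i)\<close> recovers \<open>d i\<close>.\<close>
  have d_norm: "d i = (A *\<^sub>v col Q i) \<bullet> (A *\<^sub>v col Q i)" if i: "i < n" for i
  proof -
    have "(A *\<^sub>v col Q i) \<bullet> (A *\<^sub>v col Q i) = (A\<^sup>T *\<^sub>v (A *\<^sub>v col Q i)) \<bullet> col Q i"
      using scalar_prod_mult_mat_vec[OF A _ qc] A qc by simp
    also have "\<dots> = d i * (col Q i \<bullet> col Q i)" unfolding eig[OF i] using qc by simp
    also have "col Q i \<bullet> col Q i = 1" using orthonormal_iff_scalar_prod[OF Q(1)] Q(2) i by simp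
    finally show ?thesis by simp
  qed
  have d_nonneg: "0 \<le> d i" if "i < n" for i
    unfolding d_norm[OF that] vnorm_square[symmetric] by simp
  have "similar_mat_wit (A\<^sup>T * A) D Q Q\<^sup>T"
    \<comment> \<open>Similarity identifies the characteristic polynomials, so the multiset of roots
      is the diagonal of \<open>D\<close> with multiplicities.\<close>
    unfolding similar_mat_wit_def Let_def using S D(1) Q QQ eq by auto
  then have "char_poly (A\<^sup>T * A) = char_poly D" by (intro char_poly_similar) (auto simp: similar_mat_def)
  also have "\<dots> = (\<Prod>e\<leftarrow>diag_mat D. [:- e, 1:])"
    using D by (intro char_poly_upper_triangular[OF D(1)]) (auto simp: diagonal_mat_def)
  finally have "proots (char_poly (A\<^sup>T * A)) = mset (diag_mat D)"
    using proots_prod_linear_factors by simp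
  also have "diag_mat D = map d [0..<n]" using D(1) by (auto simp: diag_mat_def d_def)
  finally have sv: "singular_values A = rev (sorted_list_of_multiset (image_mset s (mset [0..<n])))"
    unfolding singular_values_def by (simp add: multiset.map_comp o_def s_def[abs_def])
  define L where "L = singular_values A"
  have msL: "mset L = image_mset s (mset [0..<n])" unfolding L_def sv by simp
  have sortL: "sorted (rev L)" unfolding L_def sv by simp
  have lenL: "length L = n" using arg_cong[OF msL, of size] by simp
  then obtain a L' where L: "L = a # L'" using n by (cases L) auto
  have "a \<in># image_mset s (mset [0..<n])" unfolding msL[symmetric] L by simp
  then obtain m where m: "m < n" "a = s m" by auto
  have "mset [0..<n] = add_mset m (mset [0..<n] - {#m#})" using m by simp
  then have "image_mset s (mset [0..<n]) = add_mset (s m) (image_mset s (mset [0..<n] - {#m#}))"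
    by (metis image_mset_add_mset)
  \<comment> \<open>Exactly one occurrence of the index \<open>m\<close> is removed. With ties,
    every other index still contributes to \<open>L'\<close> and is bounded by its head, the second
    singular value.\<close>
  then have msL': "mset L' = image_mset s (mset [0..<n] - {#m#})"
    using msL m unfolding L by simp
  have desc: "sorted_wrt (\<ge>) L" using sortL by (simp add: sorted_wrt_rev)
  show ?thesis
  \<comment> \<open>Outside the index range \<open>s\<close> is set to 0, so that nonnegativity
    holds for every argument.\<close>
  proof (rule that[OF Q, of "\<lambda>i. if i < n then s i else 0" m])
    show "0 \<le> (if i < n then s i else 0)" for i using d_nonneg by (simp add: s_def)
    show "A\<^sup>T *\<^sub>v (A *\<^sub>v col Q i) = (if i < n then s i else 0)\<^sup>2 \<cdot>\<^sub>v col Q i" if "i < n" for i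
      using eig[OF that] d_nonneg[OF that] that by (simp add: s_def)
    show "m < n" by fact
    show "singular_value A 1 = (if m < n then s m else 0)"
      using lenL n m unfolding singular_value_def L_def[symmetric] by (simp add: L)
    show "(if i < n then s i else 0) \<le> (if m < n then s m else 0)" if "i < n" for i
    proof -
      have "s i \<in> set L" unfolding set_mset_mset[symmetric] msL using that by auto
      then show ?thesis using desc m that unfolding L by auto
    qed
    show "(if i < n then s i else 0) \<le> singular_value A 2" if "i < n" "i \<noteq> m" for i
    proof -
      have "i \<in># mset [0..<n] - {#m#}" using that by (simp add: in_diff_count)
      then have "s i \<in> set L'" unfolding set_mset_mset[symmetric] msL' by auto
      then obtain b L'' where L': "L' = b # L''" by (cases L') auto
      have "s i \<le> b" using \<open>s i \<in> set L'\<close> desc unfolding L L' by auto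
      moreover have "singular_value A 2 = b"
        using lenL unfolding singular_value_def L_def[symmetric] by (simp add: L L')
      ultimately show ?thesis using that by simp
    qed
    show "0 \<le> singular_value A 2"
    proof (cases L')
      \<comment> \<open>Here \<open>n = 1\<close>, and the second singular value is the default
        0.\<close>
      case Nil
      then show ?thesis using lenL unfolding singular_value_def L_def[symmetric] by (simp add: L)
    next
      case (Cons b L'')
      then have "b \<in> set L'" by simp
      then have "b \<in> s ` {0..<n}" unfolding set_mset_mset[symmetric] msL' by (auto dest: in_diffD)
      then show ?thesis using lenL d_nonneg Cons
        unfolding singular_value_def L_def[symmetric] by (auto simp: L s_def)
    qed
  qed
qed

text \<open>Parseval for \<open>|A x|\<^sup>2 = (A\<^sup>T A x) \<bullet> x\<close>, moving
  \<open>A\<^sup>T A\<close> onto the eigenvectors.\<close>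

lemma gram_form_singular_basis:
  assumes A: "A \<in> carrier_mat n n" and Q: "Q \<in> carrier_mat n n" "Q\<^sup>T * Q = 1\<^sub>m n"
    and eig: "\<And>i. i < n \<Longrightarrow> A\<^sup>T *\<^sub>v (A *\<^sub>v col Q i) = (s i)\<^sup>2 \<cdot>\<^sub>v col Q i"
    and x: "x \<in> carrier_vec n"
  shows "(vnorm (A *\<^sub>v x))\<^sup>2 = (\<Sum>i<n. (s i)\<^sup>2 * (col Q i \<bullet> x)\<^sup>2)"
proof -
  have qc: "col Q i \<in> carrier_vec n" for i using Q(1) by (simp add: carrier_vecI)
  have "(vnorm (A *\<^sub>v x))\<^sup>2 = (A\<^sup>T *\<^sub>v (A *\<^sub>v x)) \<bullet> x"
    unfolding vnorm_square using scalar_prod_mult_mat_vec[OF A _ x] A x by simp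
  also have "\<dots> = (\<Sum>i<n. (col Q i \<bullet> (A\<^sup>T *\<^sub>v (A *\<^sub>v x))) * (col Q i \<bullet> x))"
    by (rule scalar_prod_orthonormal_basis[OF Q]) (use A x in auto)
  also have "\<dots> = (\<Sum>i<n. (s i)\<^sup>2 * (col Q i \<bullet> x)\<^sup>2)"
  proof (rule sum.cong[OF refl])
    fix i assume "i \<in> {..<n}"
    then have i: "i < n" by simp
    have "col Q i \<bullet> (A\<^sup>T *\<^sub>v (A *\<^sub>v x)) = (A *\<^sub>v col Q i) \<bullet> (A *\<^sub>v x)"
      using scalar_prod_mult_mat_vec[of "A\<^sup>T" n n "col Q i" "A *\<^sub>v x"] A x qc by simp
    also have "\<dots> = (A\<^sup>T *\<^sub>v (A *\<^sub>v col Q i)) \<bullet> x"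
      using scalar_prod_mult_mat_vec[OF A _ x] A qc by simp
    also have "\<dots> = (s i)\<^sup>2 * (col Q i \<bullet> x)" unfolding eig[OF i] by (rule smult_scalar_prod_distrib[OF qc x])
    finally show "(col Q i \<bullet> (A\<^sup>T *\<^sub>v (A *\<^sub>v x))) * (col Q i \<bullet> x) = (s i)\<^sup>2 * (col Q i \<bullet> x)\<^sup>2"
      by (simp add: power2_eq_square)
  qed
  finally show ?thesis .
qed

lemma vnorm_orthonormal_basis:
  assumes "Q \<in> carrier_mat n n" "Q\<^sup>T * Q = 1\<^sub>m n" "x \<in> carrier_vec n"
  shows "(vnorm x)\<^sup>2 = (\<Sum>i<n. (col Q i \<bullet> x)\<^sup>2)"
  using scalar_prod_orthonormal_basis[OF assms(1,2,3,3)] unfolding vnorm_square by (simp add: power2_eq_square)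

section \<open>Norm bounds by the first two singular values\<close>

lemma vnorm_mult_le_singular_value:
  assumes A: "A \<in> carrier_mat n n" and n: "n > 0" and x: "x \<in> carrier_vec n"
  shows "vnorm (A *\<^sub>v x) \<le> singular_value A 1 * vnorm x"
proof -
  obtain Q s m where Q: "Q \<in> carrier_mat n n" "Q\<^sup>T * Q = 1\<^sub>m n" and s: "\<And>i. 0 \<le> s i"
    and eig: "\<And>i. i < n \<Longrightarrow> A\<^sup>T *\<^sub>v (A *\<^sub>v col Q i) = (s i)\<^sup>2 \<cdot>\<^sub>v col Q i"
    and m: "singular_value A 1 = s m" "\<And>i. i < n \<Longrightarrow> s i \<le> s m"
    by (rule right_singular_basis_exists[OF A n]) blast
  have "(vnorm (A *\<^sub>v x))\<^sup>2 \<le> (\<Sum>i<n. (s m)\<^sup>2 * (col Q i \<bullet> x)\<^sup>2)"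
    unfolding gram_form_singular_basis[where s = s, OF A Q eig x, simplified]
    using s m(2) by (intro sum_mono mult_right_mono power_mono) auto
  also have "\<dots> = (s m * vnorm x)\<^sup>2"
    by (simp add: power_mult_distrib vnorm_orthonormal_basis[OF Q x] sum_distrib_left)
  finally show ?thesis unfolding m(1) by (rule power2_le_imp_le) (simp add: s)
qed

text \<open>The given \<open>v\<close> need not be a column of \<open>Q\<close>. The strict gap
  makes it orthogonal to every column except number \<open>m\<close>, so it is parallel to that one;
  then \<open>x\<close> has no component there, and the other coefficients are at most the second
  singular value.\<close>

lemma vnorm_mult_le_second_singular_value:
  assumes A: "A \<in> carrier_mat n n" and n: "n > 0" and gap: "singular_value A 2 < singular_value A 1"
    and v: "v \<in> carrier_vec n" "v \<bullet> v = 1"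
      "A\<^sup>T *\<^sub>v (A *\<^sub>v v) = (singular_value A 1)\<^sup>2 \<cdot>\<^sub>v v"
    and x: "x \<in> carrier_vec n" "v \<bullet> x = 0"
  shows "vnorm (A *\<^sub>v x) \<le> singular_value A 2 * vnorm x"
proof -
  obtain Q s m where Q: "Q \<in> carrier_mat n n" "Q\<^sup>T * Q = 1\<^sub>m n" and s: "\<And>i. 0 \<le> s i"
    and eig: "\<And>i. i < n \<Longrightarrow> A\<^sup>T *\<^sub>v (A *\<^sub>v col Q i) = (s i)\<^sup>2 \<cdot>\<^sub>v col Q i"
    and m: "m < n" "singular_value A 1 = s m"
    and s2: "\<And>i. i < n \<Longrightarrow> i \<noteq> m \<Longrightarrow> s i \<le> singular_value A 2" "0 \<le> singular_value A 2"
    by (rule right_singular_basis_exists[OF A n]) blast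
  have qc: "col Q i \<in> carrier_vec n" for i using Q(1) by (simp add: carrier_vecI)
  \<comment> \<open>Eigenvectors of \<open>A\<^sup>T A\<close> for distinct eigenvalues are
    orthogonal: the product of \<open>A q\<close> and \<open>A v\<close> is evaluated in both
    ways.\<close>
  have qv: "col Q i \<bullet> v = 0" if i: "i < n" "i \<noteq> m" for i
  proof -
    have "(A *\<^sub>v col Q i) \<bullet> (A *\<^sub>v v) = (s i)\<^sup>2 * (col Q i \<bullet> v)"
      using scalar_prod_mult_mat_vec[OF A _ v(1), of "A *\<^sub>v col Q i"] A qc v(1)
      by (simp add: eig[OF i(1)] smult_scalar_prod_distrib[of _ n])
    moreover have "(A *\<^sub>v v) \<bullet> (A *\<^sub>v col Q i) = (s m)\<^sup>2 * (v \<bullet> col Q i)"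
      using scalar_prod_mult_mat_vec[OF A _ qc, of "A *\<^sub>v v" i] A qc v(1)
      unfolding v(3) m(2) by (simp add: smult_scalar_prod_distrib[of _ n])
    ultimately have "(s i)\<^sup>2 * (col Q i \<bullet> v) = (s m)\<^sup>2 * (col Q i \<bullet> v)"
      using comm_scalar_prod[of "A *\<^sub>v v" n "A *\<^sub>v col Q i"] comm_scalar_prod[of v n "col Q i"] A qc v(1)
      by simp
    moreover have "(s i)\<^sup>2 < (s m)\<^sup>2"
      using s2(1)[OF i] gap s[of i] unfolding m(2) by (intro power_strict_mono) auto
    ultimately show ?thesis by simp
  qed
  have "x \<bullet> v = (\<Sum>i<n. (col Q i \<bullet> x) * (col Q i \<bullet> v))"
    by (rule scalar_prod_orthonormal_basis[OF Q x(1) v(1)])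
  also have "\<dots> = (col Q m \<bullet> x) * (col Q m \<bullet> v)"
    using m qv by (subst sum.remove[of _ m]) (auto intro!: sum.neutral)
  finally have "(col Q m \<bullet> x) * (col Q m \<bullet> v) = 0"
    using x v(1) comm_scalar_prod[of x n v] by simp
  moreover have "(vnorm v)\<^sup>2 = (col Q m \<bullet> v)\<^sup>2"
    unfolding vnorm_orthonormal_basis[OF Q v(1)]
    using m qv by (subst sum.remove[of _ m]) (auto intro!: sum.neutral)
  then have "col Q m \<bullet> v \<noteq> 0" using v(2) by (auto simp: vnorm_square)
  ultimately have qx: "col Q m \<bullet> x = 0" by simp
  have "(vnorm (A *\<^sub>v x))\<^sup>2 \<le> (\<Sum>i<n. (singular_value A 2)\<^sup>2 * (col Q i \<bullet> x)\<^sup>2)"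
    unfolding gram_form_singular_basis[where s = s, OF A Q eig x(1), simplified]
  proof (rule sum_mono)
    fix i assume "i \<in> {..<n}"
    then show "(s i)\<^sup>2 * (col Q i \<bullet> x)\<^sup>2 \<le> (singular_value A 2)\<^sup>2 * (col Q i \<bullet> x)\<^sup>2"
      using s s2(1)[of i] qx by (cases "i = m") (auto intro!: mult_right_mono power_mono)
  qed
  also have "\<dots> = (singular_value A 2 * vnorm x)\<^sup>2"
    by (simp add: power_mult_distrib vnorm_orthonormal_basis[OF Q x(1)] sum_distrib_left)
  finally show ?thesis by (rule power2_le_imp_le) (simp add: s2(2))
qed

section \<open>Rank and reduced singular bases\<close>

text \<open>Orthonormal columns are linearly independent, and the columns of \<open>A * X\<close>
  lie in the column space of \<open>A\<close>, whose dimension is the rank. This connects the number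
  of nonzero singular values with the rank.\<close>

lemma orthonormal_in_col_space_le_rank:
  fixes A :: "real mat"
  assumes A: "A \<in> carrier_mat n n" and X: "X \<in> carrier_mat n r"
    and orth: "(A * X)\<^sup>T * (A * X) = 1\<^sub>m r"
  shows "r \<le> vec_space.rank n A"
proof -
  interpret vec_space "TYPE(real)" n .
  define U where "U = A * X"
  have U: "U \<in> carrier_mat n r" using A X by (simp add: U_def)
  have orth': "col U i \<bullet> col U j = (if i = j then 1 else 0)" if "i < r" "j < r" for i j
    using orthonormal_iff_scalar_prod[OF U] orth that unfolding U_def by blast
  have dist: "distinct (cols U)"
    unfolding distinct_conv_nth
  proof (intro allI impI)
    fix i j assume ij: "i < length (cols U)" "j < length (cols U)" "i \<noteq> j"
    then have "col U i \<bullet> col U j \<noteq> col U i \<bullet> col U i" using orth' U by auto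
    then show "cols U ! i \<noteq> cols U ! j" using ij by auto
  qed
  have indpt: "lin_indpt (set (cols U))"
  proof
    assume "lin_dep (set (cols U))"
    then obtain v where v: "v \<in> carrier_vec r" "v \<noteq> 0\<^sub>v r" "U *\<^sub>v v = 0\<^sub>v n"
      using lin_depE[OF U _ dist] by blast
    have "v = (U\<^sup>T * U) *\<^sub>v v" using orth v(1) unfolding U_def by simp
    also have "\<dots> = U\<^sup>T *\<^sub>v (U *\<^sub>v v)" using U v(1) by (intro assoc_mult_mat_vec) auto
    also have "\<dots> = 0\<^sub>v r" unfolding v(3) using U by (intro eq_vecI) auto
    finally show False using v(2) by simp
  qed
  have cols_A: "set (cols A) \<subseteq> carrier_vec n" using A cols_dim by blast
  have "set (cols U) \<subseteq> span (set (cols A))"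
  proof
    fix u assume "u \<in> set (cols U)"
    then obtain i where i: "i < r" "u = col U i" using U by (auto simp: cols_def)
    have "u = A *\<^sub>v col X i" unfolding i(2) U_def using A X i(1) by (simp add: mult_mat_vec_def)
    then show "u \<in> span (set (cols A))"
      using col_space_eq[OF A] A X i(1) unfolding col_space_def by auto
  qed
  moreover have sub: "submodule class_ring (span (set (cols A))) V"
    using cols_A span_is_submodule by simp
  ultimately have "\<not> module.lin_dep class_ring (vs (span (set (cols A)))) (set (cols U))"
    using span_li_not_depend(2) indpt by blast
  moreover have "vectorspace class_ring (vs (span (set (cols A))))"
    using cols_A span_is_subspace subspace_is_vs by simp
  ultimately have "card (set (cols U)) \<le> rank A"
    unfolding rank_def
    using vectorspace.li_le_dim(2)[OF _ fin_dim_span_cols[OF A]] \<open>set (cols U) \<subseteq> span (set (cols A))\<close>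
    by simp
  then show ?thesis using distinct_card[OF dist] U by simp
qed

text \<open>A reduced singular value decomposition: \<open>V\<close> collects the right singular
  vectors \<open>q\<close> with nonzero singular value \<open>s\<close>, and \<open>U\<close> the
  vectors \<open>A q / s\<close>. The last two properties say that \<open>A\<^sup>T\<close> and
  \<open>A\<close> vanish on the orthogonal complements of the ranges. An inequality for
  \<open>r\<close> is enough, since the final bound increases with the rank.\<close>

lemma reduced_orthonormal_bases_exist:
  fixes A :: "real mat"
  assumes A: "A \<in> carrier_mat n n" and n: "n > 0"
  obtains r U V where "r \<le> vec_space.rank n A" "U \<in> carrier_mat n r" "V \<in> carrier_mat n r"
    "U\<^sup>T * U = 1\<^sub>m r" "V\<^sup>T * V = 1\<^sub>m r"
    "\<And>y. y \<in> carrier_vec n \<Longrightarrow> U\<^sup>T *\<^sub>v y = 0\<^sub>v r \<Longrightarrow> A\<^sup>T *\<^sub>v y = 0\<^sub>v n"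
    "\<And>x. x \<in> carrier_vec n \<Longrightarrow> V\<^sup>T *\<^sub>v x = 0\<^sub>v r \<Longrightarrow> A *\<^sub>v x = 0\<^sub>v n"
proof -
  obtain Q s m where Q: "Q \<in> carrier_mat n n" "Q\<^sup>T * Q = 1\<^sub>m n" and s: "\<And>i. 0 \<le> s i"
    and eig: "\<And>i. i < n \<Longrightarrow> A\<^sup>T *\<^sub>v (A *\<^sub>v col Q i) = (s i)\<^sup>2 \<cdot>\<^sub>v col Q i"
    by (rule right_singular_basis_exists[OF A n]) blast
  have qc: "col Q i \<in> carrier_vec n" for i using Q(1) by (simp add: carrier_vecI)
  have qq: "col Q i \<bullet> col Q j = (if i = j then 1 else 0)" if "i < n" "j < n" for i j
    using orthonormal_iff_scalar_prod[OF Q(1)] Q(2) that by blast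
  have Aq: "(A *\<^sub>v col Q i) \<bullet> (A *\<^sub>v col Q j) = (s i)\<^sup>2 * (if i = j then 1 else 0)"
    if "i < n" "j < n" for i j
  proof -
    have "(A *\<^sub>v col Q i) \<bullet> (A *\<^sub>v col Q j) = (A\<^sup>T *\<^sub>v (A *\<^sub>v col Q i)) \<bullet> col Q j"
      using A qc by (intro scalar_prod_mult_mat_vec) auto
    also have "\<dots> = (s i)\<^sup>2 * (col Q i \<bullet> col Q j)"
      unfolding eig[OF that(1)] by (rule smult_scalar_prod_distrib[OF qc qc])
    finally show ?thesis unfolding qq[OF that] .
  qed
  define js where "js = filter (\<lambda>i. s i \<noteq> 0) [0..<n]"
  define r where "r = length js"
  have js: "js ! k < n" "s (js ! k) \<noteq> 0" if "k < r" for k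
    using that nth_mem[of k js] by (auto simp: js_def r_def)
  have js_inj: "js ! k = js ! l \<longleftrightarrow> k = l" if "k < r" "l < r" for k l
    using that nth_eq_iff_index_eq[of js k l] by (simp add: js_def r_def)
  have js_ex: "\<exists>k<r. i = js ! k" if "i < n" "s i \<noteq> 0" for i
  proof -
    have "i \<in> set js" using that by (simp add: js_def)
    then show ?thesis by (auto simp: in_set_conv_nth r_def)
  qed
  define V where "V = mat_of_cols n (map (\<lambda>i. col Q i) js)"
  \<comment> \<open>The division by \<open>s i\<close> is placed in \<open>X\<close>, so that
    \<open>U\<close> has the form \<open>A * X\<close> required for the comparison with the
    rank.\<close>
  define X where "X = mat_of_cols n (map (\<lambda>i. inverse (s i) \<cdot>\<^sub>v col Q i) js)"
  define U where "U = A * X"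
  have V: "V \<in> carrier_mat n r" and X: "X \<in> carrier_mat n r"
    unfolding V_def X_def r_def by (auto simp: mat_of_cols_def)
  have U: "U \<in> carrier_mat n r" using A X by (simp add: U_def)
  have Vcol: "col V k = col Q (js ! k)" if "k < r" for k
    unfolding V_def using that qc by (subst col_mat_of_cols) (auto simp: r_def)
  have Xcol: "col X k = inverse (s (js ! k)) \<cdot>\<^sub>v col Q (js ! k)" if "k < r" for k
    unfolding X_def using that qc by (subst col_mat_of_cols) (auto simp: r_def)
  have Ucol: "col U k = inverse (s (js ! k)) \<cdot>\<^sub>v (A *\<^sub>v col Q (js ! k))" if k: "k < r" for k
  proof -
    have "col U k = A *\<^sub>v col X k"
      unfolding U_def by (rule col_mult2[OF A X k])
    then show ?thesis unfolding Xcol[OF k] using mult_mat_vec[OF A qc] by simp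
  qed
  have UU: "U\<^sup>T * U = 1\<^sub>m r"
    unfolding orthonormal_iff_scalar_prod[OF U]
  proof (intro allI impI)
    fix k l assume kl: "k < r" "l < r"
    have "A *\<^sub>v col Q (js ! k) \<in> carrier_vec n" "A *\<^sub>v col Q (js ! l) \<in> carrier_vec n"
      using A qc by auto
    then have "col U k \<bullet> col U l = inverse (s (js ! l)) * (inverse (s (js ! k)) * ((A *\<^sub>v col Q (js ! k)) \<bullet> (A *\<^sub>v col Q (js ! l))))"
      unfolding Ucol[OF kl(1)] Ucol[OF kl(2)] by (simp del: dim_mult_mat_vec)
    then show "col U k \<bullet> col U l = (if k = l then 1 else 0)"
      unfolding Aq[OF js(1)[OF kl(1)] js(1)[OF kl(2)]] using js_inj[OF kl] js(2)[OF kl(1)]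
      by (cases "k = l") (simp_all add: power2_eq_square field_simps)
  qed
  have VV: "V\<^sup>T * V = 1\<^sub>m r"
    unfolding orthonormal_iff_scalar_prod[OF V]
  proof (intro allI impI)
    fix k l assume kl: "k < r" "l < r"
    show "col V k \<bullet> col V l = (if k = l then 1 else 0)"
      unfolding Vcol[OF kl(1)] Vcol[OF kl(2)] 
      using qq[OF js(1)[OF kl(1)] js(1)[OF kl(2)]] js_inj[OF kl] by simp
  qed
  have "r \<le> vec_space.rank n A"
    using orthonormal_in_col_space_le_rank[OF A X] UU by (simp add: U_def)
  moreover have "A\<^sup>T *\<^sub>v y = 0\<^sub>v n" if y: "y \<in> carrier_vec n" "U\<^sup>T *\<^sub>v y = 0\<^sub>v r" for y
  proof -
    have Aty: "A\<^sup>T *\<^sub>v y \<in> carrier_vec n" using A y by simp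
    have "col Q i \<bullet> (A\<^sup>T *\<^sub>v y) = 0" if i: "i < n" for i
    proof -
      have Aqc: "A *\<^sub>v col Q i \<in> carrier_vec n" using A qc by simp
      have eq: "col Q i \<bullet> (A\<^sup>T *\<^sub>v y) = (A *\<^sub>v col Q i) \<bullet> y"
        using scalar_prod_mult_mat_vec[of "A\<^sup>T" n n "col Q i" y] A y qc by simp
      show ?thesis
      \<comment> \<open>Either \<open>A\<close> annihilates the basis vector, or its image is a
        multiple of a column of \<open>U\<close>.\<close>
      proof (cases "s i = 0")
        case True
        then have "vnorm (A *\<^sub>v col Q i) = 0" using Aq[OF i i] by (simp add: vnorm_def)
        then have "A *\<^sub>v col Q i = 0\<^sub>v n" using vnorm_eq_0_imp[OF Aqc] by simp
        then show ?thesis unfolding eq using y(1) by simp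
      next
        case False
        then obtain k where k: "k < r" "i = js ! k" using js_ex[OF i] by blast
        have "col U k \<bullet> y = 0" using arg_cong[OF y(2), of "\<lambda>v. v $ k"] k U by simp
        then show ?thesis unfolding eq Ucol[OF k(1)] k(2)[symmetric]
          smult_scalar_prod_distrib[OF Aqc y(1)] using False by simp
      qed
    qed
    then have "(vnorm (A\<^sup>T *\<^sub>v y))\<^sup>2 = 0" unfolding vnorm_orthonormal_basis[OF Q Aty] by simp
    then show ?thesis using vnorm_eq_0_imp[OF Aty] by simp
  qed
  moreover have "A *\<^sub>v x = 0\<^sub>v n" if x: "x \<in> carrier_vec n" "V\<^sup>T *\<^sub>v x = 0\<^sub>v r" for x
  proof -
    have Ax: "A *\<^sub>v x \<in> carrier_vec n" using A x by simp
    have "(s i)\<^sup>2 * (col Q i \<bullet> x)\<^sup>2 = 0" if i: "i < n" for i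
    proof (cases "s i = 0")
      case False
      then obtain k where k: "k < r" "i = js ! k" using js_ex[OF i] by blast
      have "col V k \<bullet> x = 0" using arg_cong[OF x(2), of "\<lambda>v. v $ k"] k V by simp
      then show ?thesis unfolding Vcol[OF k(1)] k(2)[symmetric] by simp
    qed simp
    then have "(vnorm (A *\<^sub>v x))\<^sup>2 = 0"
      unfolding gram_form_singular_basis[where s = s, OF A Q eig x(1), simplified] by (intro sum.neutral) auto
    then show ?thesis using vnorm_eq_0_imp[OF Ax] by simp
  qed
  ultimately show ?thesis using that U V UU VV by blast
qed

section \<open>Perturbation of the top singular vectors\<close>

lemma transpose_mult_residual:
  fixes U :: "real mat"
  assumes U: "U \<in> carrier_mat n r" "U\<^sup>T * U = 1\<^sub>m r" and x: "x \<in> carrier_vec n"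
  shows "U\<^sup>T *\<^sub>v (x - U *\<^sub>v (U\<^sup>T *\<^sub>v x)) = 0\<^sub>v r"
proof -
  have "U\<^sup>T *\<^sub>v (U *\<^sub>v (U\<^sup>T *\<^sub>v x)) = U\<^sup>T *\<^sub>v x"
    using assoc_mult_mat_vec[of "U\<^sup>T" r n U r "U\<^sup>T *\<^sub>v x"] U x by simp
  then show ?thesis using U(1) x by (simp add: mult_minus_distrib_mat_vec[of _ r n])
qed

lemma residual_orthogonal:
  fixes U :: "real mat"
  assumes U: "U \<in> carrier_mat n r" "U\<^sup>T * U = 1\<^sub>m r" and x: "x \<in> carrier_vec n" and z: "z \<in> carrier_vec r"
  shows "(x - U *\<^sub>v (U\<^sup>T *\<^sub>v x)) \<bullet> (U *\<^sub>v z) = 0"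
  using scalar_prod_mult_mat_vec[OF U(1) _ z, of "x - U *\<^sub>v (U\<^sup>T *\<^sub>v x)"]
    transpose_mult_residual[OF U x] U(1) x z by simp

text \<open>Cauchy-Schwarz on \<open>|U\<^sup>T x|\<^sup>2 = x \<bullet> U (U\<^sup>T x)\<close>,
  followed by cancelling one factor.\<close>

lemma vnorm_transpose_isometry_le:
  fixes U :: "real mat"
  assumes U: "U \<in> carrier_mat n r" "U\<^sup>T * U = 1\<^sub>m r" and x: "x \<in> carrier_vec n"
  shows "vnorm (U\<^sup>T *\<^sub>v x) \<le> vnorm x"
proof -
  let ?z = "U\<^sup>T *\<^sub>v x"
  have z: "?z \<in> carrier_vec r" using U x by simp
  have "vnorm ?z * vnorm ?z = x \<bullet> (U *\<^sub>v ?z)"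
    unfolding vnorm_mult_self by (rule scalar_prod_mult_mat_vec[OF U(1) x z, symmetric])
  also have "\<dots> \<le> vnorm x * vnorm (U *\<^sub>v ?z)" using U x z by (intro Cauchy_Schwarz_vec) auto
  also have "vnorm (U *\<^sub>v ?z) = vnorm ?z" by (rule vnorm_isometry[OF U z])
  finally show ?thesis using vnorm_nonneg[of ?z]
    by (cases "vnorm ?z = 0") (auto simp: mult_le_cancel_right)
qed

text \<open>\<open>a\<close> is a unit vector in the range of \<open>U\<close>; \<open>p\<close> and \<open>q\<close> are the components of \<open>b\<close> inside that
  range but orthogonal to \<open>a\<close>, and orthogonal to that range.\<close>

lemma range_decomposition:
  fixes U :: "real mat"
  assumes U: "U \<in> carrier_mat n r" "U\<^sup>T * U = 1\<^sub>m r"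
    and a: "a \<in> carrier_vec n" "a \<bullet> a = 1" "U *\<^sub>v (U\<^sup>T *\<^sub>v a) = a"
    and b: "b \<in> carrier_vec n"
  defines "p \<equiv> U *\<^sub>v (U\<^sup>T *\<^sub>v b) - (a \<bullet> b) \<cdot>\<^sub>v a" and "q \<equiv> b - U *\<^sub>v (U\<^sup>T *\<^sub>v b)"
  shows "p \<in> carrier_vec n" "q \<in> carrier_vec n" "a \<bullet> p = 0" "p \<bullet> p = p \<bullet> b" "q \<bullet> q = q \<bullet> b"
    "b \<bullet> b - (a \<bullet> b)\<^sup>2 = p \<bullet> p + q \<bullet> q"
    "\<exists>z\<in>carrier_vec r. p = U *\<^sub>v z \<and> vnorm z = vnorm p"
proof -
  define Pb where "Pb = U *\<^sub>v (U\<^sup>T *\<^sub>v b)"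
  have c: "U\<^sup>T *\<^sub>v b \<in> carrier_vec r" "U\<^sup>T *\<^sub>v a \<in> carrier_vec r" "Pb \<in> carrier_vec n"
    using U a b by (auto simp: Pb_def)
  show p: "p \<in> carrier_vec n" and q: "q \<in> carrier_vec n" using a b c by (auto simp: p_def q_def Pb_def[symmetric])
  have qU: "q \<bullet> (U *\<^sub>v z) = 0" if "z \<in> carrier_vec r" for z
    unfolding q_def by (rule residual_orthogonal[OF U b that])
  \<comment> \<open>These are the coordinates of \<open>p\<close> with respect to \<open>U\<close>,
    which make the compression bound applicable to \<open>p\<close>.\<close>
  define z where "z = U\<^sup>T *\<^sub>v b - (a \<bullet> b) \<cdot>\<^sub>v (U\<^sup>T *\<^sub>v a)"
  have z: "z \<in> carrier_vec r" using c by (simp add: z_def)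
  have pz: "p = U *\<^sub>v z"
    unfolding z_def p_def using U(1) c a(3)
    by (simp add: mult_minus_distrib_mat_vec[of _ n r] mult_mat_vec[of _ n r])
  show "\<exists>z\<in>carrier_vec r. p = U *\<^sub>v z \<and> vnorm z = vnorm p"
    using z pz vnorm_isometry[OF U z] by auto
  have bq: "b = Pb + q" unfolding q_def Pb_def[symmetric] using b c by (auto intro!: eq_vecI)
  have "q \<bullet> a = 0" using qU[OF c(2)] a(3) by simp
  then have aq: "a \<bullet> q = 0" using comm_scalar_prod[OF a(1) q] by simp
  have "a \<bullet> b = a \<bullet> Pb" using aq a(1) c q by (simp add: bq scalar_prod_add_distrib[of _ n])
  then show ap: "a \<bullet> p = 0" unfolding p_def Pb_def[symmetric]
    using a(1,2) c by (simp add: scalar_prod_minus_distrib[of _ n] scalar_prod_smult_distrib[of _ n])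
  have pq: "p \<bullet> q = 0" using qU[OF z] comm_scalar_prod[OF p q] unfolding pz by simp
  have Pb: "Pb = p + (a \<bullet> b) \<cdot>\<^sub>v a" unfolding p_def Pb_def[symmetric] using a(1) c by (auto intro!: eq_vecI)
  have pa: "p \<bullet> a = 0" using ap comm_scalar_prod[OF p a(1)] by simp
  have "p \<bullet> Pb = p \<bullet> p" unfolding Pb using p a(1) pa
    by (simp add: scalar_prod_add_distrib[of _ n] scalar_prod_smult_distrib[of _ n])
  then show pb: "p \<bullet> p = p \<bullet> b" unfolding bq using p q c pq by (simp add: scalar_prod_add_distrib[of _ n])
  have "q \<bullet> Pb = 0" unfolding Pb_def by (rule qU[OF c(1)])
  then show qb: "q \<bullet> q = q \<bullet> b" unfolding bq using q c by (simp add: scalar_prod_add_distrib[of _ n])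
  have "b \<bullet> b = (p + (a \<bullet> b) \<cdot>\<^sub>v a + q) \<bullet> b" using bq Pb by simp
  also have "\<dots> = p \<bullet> b + (a \<bullet> b) * (a \<bullet> b) + q \<bullet> b"
    using p q a(1) b by (simp add: add_scalar_prod_distrib[of _ n] smult_scalar_prod_distrib[of _ n])
  finally show "b \<bullet> b - (a \<bullet> b)\<^sup>2 = p \<bullet> p + q \<bullet> q" using pb qb by (simp add: power2_eq_square)
qed

text \<open>The residual \<open>y\<close> of \<open>u\<close> is annihilated by
  \<open>A\<^sup>T\<close>, so \<open>\<sigma> * (y \<bullet> u) = y \<bullet> A v = 0\<close>. It
  is also orthogonal to the range of \<open>U\<close>, hence to itself.\<close>

lemma range_contains_singular_vector:
  fixes A :: "real mat"
  assumes A: "A \<in> carrier_mat n n" and U: "U \<in> carrier_mat n r" "U\<^sup>T * U = 1\<^sub>m r"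
    and ker: "\<And>y. y \<in> carrier_vec n \<Longrightarrow> U\<^sup>T *\<^sub>v y = 0\<^sub>v r \<Longrightarrow> A\<^sup>T *\<^sub>v y = 0\<^sub>v n"
    and u: "u \<in> carrier_vec n" and v: "v \<in> carrier_vec n" and eq: "A *\<^sub>v v = \<sigma> \<cdot>\<^sub>v u" and \<sigma>: "\<sigma> \<noteq> 0"
  shows "U *\<^sub>v (U\<^sup>T *\<^sub>v u) = u"
proof -
  define y where "y = u - U *\<^sub>v (U\<^sup>T *\<^sub>v u)"
  have c: "U\<^sup>T *\<^sub>v u \<in> carrier_vec r" "U *\<^sub>v (U\<^sup>T *\<^sub>v u) \<in> carrier_vec n" using U u by auto
  have y: "y \<in> carrier_vec n" unfolding y_def using u c by simp
  have "A\<^sup>T *\<^sub>v y = 0\<^sub>v n" using ker[OF y] transpose_mult_residual[OF U u] by (simp add: y_def)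
  then have "y \<bullet> (A *\<^sub>v v) = 0" using scalar_prod_mult_mat_vec[OF A y v] v by simp
  then have yu: "y \<bullet> u = 0" unfolding eq using \<sigma> y u by (simp add: scalar_prod_smult_distrib[of _ n])
  have yU: "y \<bullet> (U *\<^sub>v (U\<^sup>T *\<^sub>v u)) = 0" unfolding y_def by (rule residual_orthogonal[OF U u c(1)])
  have "y \<bullet> y = y \<bullet> (u - U *\<^sub>v (U\<^sup>T *\<^sub>v u))" unfolding y_def ..
  also have "\<dots> = 0" using scalar_prod_minus_distrib[OF y u c(2)] yu yU by simp
  finally have y0: "y = 0\<^sub>v n" using vnorm_eq_0_imp[OF y] by (simp add: vnorm_def)
  have "u = y + U *\<^sub>v (U\<^sup>T *\<^sub>v u)" unfolding y_def using u c U(1) by (auto intro!: eq_vecI)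
  then show ?thesis unfolding y0 using c by simp
qed

text \<open>For the first bound, \<open>eq2\<close> is tested against \<open>w\<close>: as
  \<open>A w = 0\<close>, only \<open>E\<close> contributes. For the second, \<open>eq1\<close> is
  tested against \<open>p\<close>: being orthogonal to \<open>u\<close>, it sees \<open>A\<close>
  only through \<open>s\<close>, while \<open>E\<close> acts by its compression on the projected
  part of \<open>v'\<close> and with full norm only on the small \<open>w\<close>. The form is
  one-sided so that it can be applied again to the transposes.\<close>

lemma perturbed_singular_vector_bounds:
  fixes A E U V :: "real mat" and u v u' v' :: "real Matrix.vec" and \<sigma> \<sigma>\<^sub>2 \<sigma>' \<kappa> \<tau> :: real
  assumes A: "A \<in> carrier_mat n n" and E: "E \<in> carrier_mat n n"
    and U: "U \<in> carrier_mat n r" "U\<^sup>T * U = 1\<^sub>m r" and V: "V \<in> carrier_mat n r" "V\<^sup>T * V = 1\<^sub>m r"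
    and kerV: "\<And>x. x \<in> carrier_vec n \<Longrightarrow> V\<^sup>T *\<^sub>v x = 0\<^sub>v r \<Longrightarrow> A *\<^sub>v x = 0\<^sub>v n"
    and u: "u \<in> carrier_vec n" "u \<bullet> u = 1" "U *\<^sub>v (U\<^sup>T *\<^sub>v u) = u"
    and v: "v \<in> carrier_vec n" "v \<bullet> v = 1" "V *\<^sub>v (V\<^sup>T *\<^sub>v v) = v"
    and Av: "A *\<^sub>v v = \<sigma> \<cdot>\<^sub>v u"
    and second: "\<And>x. x \<in> carrier_vec n \<Longrightarrow> v \<bullet> x = 0 \<Longrightarrow> vnorm (A *\<^sub>v x) \<le> \<sigma>\<^sub>2 * vnorm x"
    and u': "u' \<in> carrier_vec n" "u' \<bullet> u' = 1" and v': "v' \<in> carrier_vec n" "v' \<bullet> v' = 1"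
    and eq1: "(A + E) *\<^sub>v v' = \<sigma>' \<cdot>\<^sub>v u'" and eq2: "(A + E)\<^sup>T *\<^sub>v u' = \<sigma>' \<cdot>\<^sub>v v'"
    and \<kappa>: "0 \<le> \<kappa>" and \<tau>: "0 \<le> \<tau>"
    and E_le: "\<And>x y. x \<in> carrier_vec n \<Longrightarrow> y \<in> carrier_vec n \<Longrightarrow> x \<bullet> (E *\<^sub>v y) \<le> \<kappa> * (vnorm x * vnorm y)"
    and UEV_le: "\<And>x y. x \<in> carrier_vec r \<Longrightarrow> y \<in> carrier_vec r \<Longrightarrow>
      (U *\<^sub>v x) \<bullet> (E *\<^sub>v (V *\<^sub>v y)) \<le> \<tau> * (vnorm x * vnorm y)"
  defines "p \<equiv> U *\<^sub>v (U\<^sup>T *\<^sub>v u') - (u \<bullet> u') \<cdot>\<^sub>v u"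
    and "s \<equiv> V *\<^sub>v (V\<^sup>T *\<^sub>v v') - (v \<bullet> v') \<cdot>\<^sub>v v" and "w \<equiv> v' - V *\<^sub>v (V\<^sup>T *\<^sub>v v')"
  shows "\<sigma>' * vnorm w \<le> \<kappa>"
    and "\<sigma>' * vnorm p \<le> \<sigma>\<^sub>2 * vnorm s + \<tau> + \<kappa> * vnorm w"
proof -
  note decU = range_decomposition[OF U u u'(1), folded p_def]
  note decV = range_decomposition[OF V v v'(1), folded s_def w_def]
  have p: "p \<in> carrier_vec n" "u \<bullet> p = 0" "p \<bullet> p = p \<bullet> u'" using decU(1,3,4) by auto
  have s: "s \<in> carrier_vec n" "v \<bullet> s = 0" using decV(1,3) by auto
  have w: "w \<in> carrier_vec n" "w \<bullet> w = w \<bullet> v'" using decV(2,5) by auto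
  have u'1: "vnorm u' = 1" and v'1: "vnorm v' = 1" using u'(2) v'(2) by (simp_all add: vnorm_def)
  have Mc: "M *\<^sub>v x \<in> carrier_vec n" if "M \<in> carrier_mat n n" "x \<in> carrier_vec n" for M :: "real mat" and x
    using that by simp
  have AE: "A + E \<in> carrier_mat n n" using A E by simp
  have Aw: "A *\<^sub>v w = 0\<^sub>v n" unfolding w_def
    by (rule kerV[OF _ transpose_mult_residual[OF V v'(1)]]) (use w(1) in \<open>simp add: w_def\<close>)
  \<comment> \<open>Both estimates come out multiplied by a norm that may be 0, so the cancellation
    treats that case separately.\<close>
  have le_of_mult: "a \<le> b" if "a * c \<le> b * c" "0 \<le> c" "c = 0 \<Longrightarrow> a \<le> b" for a b c :: real
    using that by (cases "c = 0") (auto simp: mult_le_cancel_right)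
  have "\<sigma>' * (vnorm w * vnorm w) = w \<bullet> (\<sigma>' \<cdot>\<^sub>v v')"
    unfolding vnorm_mult_self w(2) using w(1) v'(1) by (simp add: scalar_prod_smult_distrib[of _ n])
  also have "\<dots> = ((A + E) *\<^sub>v w) \<bullet> u'"
    unfolding eq2[symmetric] using scalar_prod_mult_mat_vec[of "(A + E)\<^sup>T" n n w u'] AE w(1) u'(1) by simp
  also have "(A + E) *\<^sub>v w = E *\<^sub>v w"
    using add_mult_distrib_mat_vec[OF A E w(1)] Aw Mc[OF E w(1)] by simp
  also have "(E *\<^sub>v w) \<bullet> u' = u' \<bullet> (E *\<^sub>v w)" by (rule comm_scalar_prod[OF Mc[OF E w(1)] u'(1)])
  also have "\<dots> \<le> \<kappa> * vnorm w" using E_le[OF u'(1) w(1)] u'1 by simp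
  finally show "\<sigma>' * vnorm w \<le> \<kappa>" 
    using \<kappa> le_of_mult[of "\<sigma>' * vnorm w" "vnorm w" \<kappa>] by (auto simp: mult.assoc)

  define Pv where "Pv = V *\<^sub>v (V\<^sup>T *\<^sub>v v')"
  have Vv: "V\<^sup>T *\<^sub>v v' \<in> carrier_vec r" using V v' by simp
  have Pv: "Pv \<in> carrier_vec n" using V Vv by (simp add: Pv_def)
  have v'_split: "v' = Pv + w" unfolding w_def Pv_def[symmetric] using v'(1) Pv by (auto intro!: eq_vecI)
  have Pv_split: "Pv = s + (v \<bullet> v') \<cdot>\<^sub>v v" unfolding s_def Pv_def[symmetric] using v(1) Pv by (auto intro!: eq_vecI)
  have pu: "p \<bullet> u = 0" using p comm_scalar_prod[OF p(1) u(1)] by simp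
  \<comment> \<open>The part \<open>w\<close> lies in the kernel of \<open>A\<close>, and the part
    along \<open>v\<close> is sent to a multiple of \<open>u\<close>, which the product with
    \<open>p\<close> removes.\<close>
  have "A *\<^sub>v v' = A *\<^sub>v Pv" using mult_add_distrib_mat_vec[OF A Pv w(1)] Aw Mc[OF A Pv] by (simp add: v'_split[symmetric])
  also have "\<dots> = A *\<^sub>v s + (v \<bullet> v') \<cdot>\<^sub>v (\<sigma> \<cdot>\<^sub>v u)"
    using mult_add_distrib_mat_vec[OF A s(1), of "(v \<bullet> v') \<cdot>\<^sub>v v"] mult_mat_vec[OF A v(1)] v(1) Av
    by (simp add: Pv_split)
  finally have Av': "A *\<^sub>v v' = A *\<^sub>v s + (v \<bullet> v') \<cdot>\<^sub>v (\<sigma> \<cdot>\<^sub>v u)" .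
  have "p \<bullet> (A *\<^sub>v v') = p \<bullet> (A *\<^sub>v s)"
    unfolding Av' using p(1) u(1) Mc[OF A s(1)] pu
    by (simp add: scalar_prod_add_distrib[of _ n] scalar_prod_smult_distrib[of _ n])
  also have "\<dots> \<le> vnorm p * vnorm (A *\<^sub>v s)" by (rule Cauchy_Schwarz_vec[OF p(1) Mc[OF A s(1)]])
  also have "\<dots> \<le> vnorm p * (\<sigma>\<^sub>2 * vnorm s)" using second[OF s] by (intro mult_left_mono) auto
  finally have pA: "p \<bullet> (A *\<^sub>v v') \<le> (\<sigma>\<^sub>2 * vnorm s) * vnorm p" by (simp add: mult.commute)
  obtain z where z: "z \<in> carrier_vec r" "p = U *\<^sub>v z" "vnorm z = vnorm p" using decU(7) by blast
  have "p \<bullet> (E *\<^sub>v v') = p \<bullet> (E *\<^sub>v Pv) + p \<bullet> (E *\<^sub>v w)"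
    using mult_add_distrib_mat_vec[OF E Pv w(1)] scalar_prod_add_distrib[OF p(1) Mc[OF E Pv] Mc[OF E w(1)]]
    by (simp add: v'_split[symmetric])
  moreover have "p \<bullet> (E *\<^sub>v Pv) \<le> \<tau> * vnorm p"
  proof -
    have "p \<bullet> (E *\<^sub>v Pv) \<le> \<tau> * (vnorm p * vnorm (V\<^sup>T *\<^sub>v v'))"
      using UEV_le[OF z(1) Vv] unfolding Pv_def z(3) z(2)[symmetric] .
    also have "\<dots> \<le> \<tau> * (vnorm p * 1)"
      using vnorm_transpose_isometry_le[OF V v'(1)] v'1 \<tau> by (intro mult_left_mono) auto
    finally show ?thesis by simp
  qed
  moreover have "p \<bullet> (E *\<^sub>v w) \<le> \<kappa> * vnorm w * vnorm p" using E_le[OF p(1) w(1)] by (simp add: ac_simps)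
  ultimately have pE: "p \<bullet> (E *\<^sub>v v') \<le> (\<tau> + \<kappa> * vnorm w) * vnorm p" by (simp add: algebra_simps)
  have "\<sigma>' * (vnorm p * vnorm p) = p \<bullet> (\<sigma>' \<cdot>\<^sub>v u')"
    unfolding vnorm_mult_self p(3) using p(1) u'(1) by (simp add: scalar_prod_smult_distrib[of _ n])
  also have "\<dots> = p \<bullet> (A *\<^sub>v v') + p \<bullet> (E *\<^sub>v v')"
    unfolding eq1[symmetric] add_mult_distrib_mat_vec[OF A E v'(1)]
    by (rule scalar_prod_add_distrib[OF p(1) Mc[OF A v'(1)] Mc[OF E v'(1)]])
  also have "\<dots> \<le> (\<sigma>\<^sub>2 * vnorm s + \<tau> + \<kappa> * vnorm w) * vnorm p" using pA pE by (simp add: algebra_simps)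
  finally have fin: "\<sigma>' * vnorm p * vnorm p \<le> (\<sigma>\<^sub>2 * vnorm s + \<tau> + \<kappa> * vnorm w) * vnorm p"
    by (simp add: mult.assoc)
  \<comment> \<open>In the case \<open>p = 0\<close> the right-hand side has to be nonnegative; for
    its first term this follows from \<open>second\<close>.\<close>
  have "0 \<le> \<sigma>\<^sub>2 * vnorm s" using second[OF s] vnorm_nonneg[of "A *\<^sub>v s"] by linarith
  moreover have "0 \<le> \<kappa> * vnorm w" using \<kappa> by simp
  ultimately show "\<sigma>' * vnorm p \<le> \<sigma>\<^sub>2 * vnorm s + \<tau> + \<kappa> * vnorm w"
    using \<tau> le_of_mult[OF fin vnorm_nonneg] by (cases "vnorm p = 0") auto
qed

section \<open>From the norm inequalities to the angle\<close>

text \<open>Here \<open>N\<close> and \<open>R\<close> stand for the square roots of the dimension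
  and the rank. Adding the bounds for \<open>p\<close> and \<open>s\<close> gives \<open>(\<sigma>'
  - \<sigma>\<^sub>2) * (p + s) \<le> 2 * K * R + K * N * (q + w)\<close>, and the first factor is
  at least \<open>\<delta> / 2\<close>. Including \<open>q\<close> or \<open>w\<close> yields
  \<open>4 * K * R + 8 * K\<^sup>2 + 2 * K\<close>, and \<open>1 \<le> R\<close> collects this into
  one multiple of \<open>R\<close>.\<close>

lemma gap_arithmetic:
  fixes K T R N \<sigma> \<sigma>\<^sub>2 \<sigma>' \<delta> p q s w :: real
  assumes K: "K > 0" and R: "1 \<le> R" and N: "0 \<le> N"
    and T: "2 * (K * R) \<le> \<delta>" and \<delta>: "\<delta> = \<sigma> - \<sigma>\<^sub>2" and \<sigma>2: "0 \<le> \<sigma>\<^sub>2"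
    and N1: "N\<^sup>2 \<le> \<sigma>" and N2: "N * \<delta> \<le> \<sigma>" and \<sigma>': "\<sigma> - K * R \<le> \<sigma>'"
    and nn: "0 \<le> p" "0 \<le> q" "0 \<le> s" "0 \<le> w"
    and q: "\<sigma>' * q \<le> K * N" and w: "\<sigma>' * w \<le> K * N"
    and p: "\<sigma>' * p \<le> \<sigma>\<^sub>2 * s + K * R + K * N * w"
    and s: "\<sigma>' * s \<le> \<sigma>\<^sub>2 * p + K * R + K * N * q"
  shows "p + q \<le> (8 * K\<^sup>2 + 6 * K) * R / \<delta>" "s + w \<le> (8 * K\<^sup>2 + 6 * K) * R / \<delta>"
proof -
  have KR: "0 < K * R" using K R by simp
  then have d: "0 < \<delta>" using T by linarith
  have s2: "\<sigma> \<le> 2 * \<sigma>'" using \<sigma>' T \<delta> \<sigma>2 by linarith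
  have s0: "0 < \<sigma>" using d \<delta> \<sigma>2 by linarith
  \<comment> \<open>Both follow from \<open>\<sigma> * x \<le> 2 * K * N\<close>: the first uses
    \<open>N * \<delta> \<le> \<sigma>\<close>, the second
    \<open>N\<^sup>2 \<le> \<sigma>\<close>.\<close>
  have small: "x * \<delta> \<le> 2 * K" "K * N * x \<le> 2 * K\<^sup>2" if x: "0 \<le> x" "\<sigma>' * x \<le> K * N" for x
  proof -
    have "\<sigma> * x \<le> 2 * \<sigma>' * x" using s2 x by (intro mult_right_mono) auto
    then have sx: "\<sigma> * x \<le> 2 * (K * N)" using x by linarith
    have "\<sigma> * (x * \<delta>) = (\<sigma> * x) * \<delta>" by simp
    also have "\<dots> \<le> 2 * (K * N) * \<delta>" using sx d by (intro mult_right_mono) auto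
    also have "\<dots> = 2 * K * (N * \<delta>)" by simp
    also have "\<dots> \<le> 2 * K * \<sigma>" using N2 K by (intro mult_left_mono) auto
    finally show "x * \<delta> \<le> 2 * K" using s0 by (simp add: mult.commute[of \<sigma>])
    have "\<sigma> * (K * N * x) = K * N * (\<sigma> * x)" by simp
    also have "\<dots> \<le> K * N * (2 * (K * N))" using sx K N by (intro mult_left_mono) auto
    also have "\<dots> = 2 * K\<^sup>2 * N\<^sup>2" by (simp add: power2_eq_square)
    also have "\<dots> \<le> 2 * K\<^sup>2 * \<sigma>" using N1 by (intro mult_left_mono) auto
    finally show "K * N * x \<le> 2 * K\<^sup>2" using s0 by (simp add: mult.commute[of \<sigma>])
  qed
  have "\<delta> / 2 * (p + s) \<le> (\<sigma>' - \<sigma>\<^sub>2) * (p + s)"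
    using \<sigma>' T \<delta> nn by (intro mult_right_mono) auto
  also have "\<dots> \<le> 2 * (K * R) + 4 * K\<^sup>2"
    using p s small(2)[OF nn(2) q] small(2)[OF nn(4) w] by (simp add: algebra_simps)
  finally have ps: "(p + s) * \<delta> \<le> 4 * (K * R) + 8 * K\<^sup>2" by (simp add: algebra_simps)
  have "K * 1 \<le> K * R" "K\<^sup>2 * 1 \<le> K\<^sup>2 * R" using R K by (intro mult_left_mono; simp)+
  then have C: "4 * (K * R) + 8 * K\<^sup>2 + 2 * K \<le> (8 * K\<^sup>2 + 6 * K) * R" by (simp add: algebra_simps)
  have "0 \<le> p * \<delta>" "0 \<le> s * \<delta>" using nn d by auto
  then have "(p + q) * \<delta> \<le> (8 * K\<^sup>2 + 6 * K) * R" "(s + w) * \<delta> \<le> (8 * K\<^sup>2 + 6 * K) * R"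
    using ps C small(1)[OF nn(2) q] small(1)[OF nn(4) w] unfolding distrib_right by linarith+
  then show "p + q \<le> (8 * K\<^sup>2 + 6 * K) * R / \<delta>" "s + w \<le> (8 * K\<^sup>2 + 6 * K) * R / \<delta>"
    using d by (simp_all add: pos_le_divide_eq)
qed

lemma sin_vec_angle:
  assumes "v \<in> carrier_vec n" "w \<in> carrier_vec n" "v \<bullet> v = 1" "w \<bullet> w = 1"
  shows "sin (vec_angle v w) = sqrt (1 - (v \<bullet> w)\<^sup>2)"
proof -
  have n1: "vnorm v = 1" "vnorm w = 1" "vnorm (- 1 \<cdot>\<^sub>v w) = 1" using assms by (simp_all add: vnorm_def vnorm_smult)
  have "v \<bullet> w \<le> 1" using Cauchy_Schwarz_vec[OF assms(1,2)] n1 by simp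
  moreover have "v \<bullet> (- 1 \<cdot>\<^sub>v w) \<le> 1" using Cauchy_Schwarz_vec[OF assms(1), of "- 1 \<cdot>\<^sub>v w"] assms(2) n1 by simp
  then have "- (v \<bullet> w) \<le> 1" using assms(1,2) scalar_prod_smult_distrib[of v n w "-1"] by simp
  ultimately have "\<bar>v \<bullet> w\<bar> \<le> 1" by linarith
  then show ?thesis unfolding vec_angle_def by (simp add: sin_arccos_abs)
qed

text \<open>The deterministic core: randomness enters only through the two bounds on
  \<open>E\<close>. Left and right vectors are treated together because each side's estimate
  involves the other's components.\<close>

lemma singular_vector_perturbation:
  fixes A E U V :: "real mat"
  assumes A: "A \<in> carrier_mat n n" and E: "E \<in> carrier_mat n n" and r: "0 < r"
    and U: "U \<in> carrier_mat n r" "U\<^sup>T * U = 1\<^sub>m r" and V: "V \<in> carrier_mat n r" "V\<^sup>T * V = 1\<^sub>m r"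
    and kerU: "\<And>y. y \<in> carrier_vec n \<Longrightarrow> U\<^sup>T *\<^sub>v y = 0\<^sub>v r \<Longrightarrow> A\<^sup>T *\<^sub>v y = 0\<^sub>v n"
    and kerV: "\<And>x. x \<in> carrier_vec n \<Longrightarrow> V\<^sup>T *\<^sub>v x = 0\<^sub>v r \<Longrightarrow> A *\<^sub>v x = 0\<^sub>v n"
    and K: "K > 0"
    and E_le: "\<And>x y. x \<in> carrier_vec n \<Longrightarrow> y \<in> carrier_vec n \<Longrightarrow>
      x \<bullet> (E *\<^sub>v y) \<le> K * sqrt (real n) * (vnorm x * vnorm y)"
    and UEV_le: "\<And>x y. x \<in> carrier_vec r \<Longrightarrow> y \<in> carrier_vec r \<Longrightarrow>
      (U *\<^sub>v x) \<bullet> (E *\<^sub>v (V *\<^sub>v y)) \<le> K * sqrt (real r) * (vnorm x * vnorm y)"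
    and \<delta>: "\<delta> = singular_value A 1 - singular_value A 2" "\<delta> > 0"
    and \<sigma>: "real n \<le> singular_value A 1" "sqrt (real n) * \<delta> \<le> singular_value A 1"
    and uv: "singular_pair A (singular_value A 1) u v"
    and uv': "singular_pair (A + E) (singular_value (A + E) 1) u' v'"
  shows "sin (vec_angle u u') \<le> (8 * K\<^sup>2 + 6 * K) * sqrt (real r) / \<delta>"
    and "sin (vec_angle v v') \<le> (8 * K\<^sup>2 + 6 * K) * sqrt (real r) / \<delta>"
proof -
  define \<sigma> \<sigma>\<^sub>2 \<sigma>' where "\<sigma> = singular_value A 1" and "\<sigma>\<^sub>2 = singular_value A 2"
    and "\<sigma>' = singular_value (A + E) 1"
  note sdefs = \<sigma>_def[symmetric] \<sigma>\<^sub>2_def[symmetric] \<sigma>'_def[symmetric]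
  have AE: "A + E \<in> carrier_mat n n" using A E by simp
  have u: "u \<in> carrier_vec n" "u \<bullet> u = 1" and v: "v \<in> carrier_vec n" "v \<bullet> v = 1"
    and Av: "A *\<^sub>v v = \<sigma> \<cdot>\<^sub>v u" and Au: "A\<^sup>T *\<^sub>v u = \<sigma> \<cdot>\<^sub>v v"
    using uv A by (auto simp: singular_pair_def unit_vector_def \<sigma>_def)
  have u': "u' \<in> carrier_vec n" "u' \<bullet> u' = 1" and v': "v' \<in> carrier_vec n" "v' \<bullet> v' = 1"
    and eq1: "(A + E) *\<^sub>v v' = \<sigma>' \<cdot>\<^sub>v u'" and eq2: "(A + E)\<^sup>T *\<^sub>v u' = \<sigma>' \<cdot>\<^sub>v v'"
    using uv' AE by (auto simp: singular_pair_def unit_vector_def \<sigma>'_def)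
  have u1: "vnorm u = 1" and v1: "vnorm v = 1" using u v by (simp_all add: vnorm_def)
  have n: "n > 0"
  proof (rule ccontr)
    assume "\<not> n > 0"
    then show False using u by (simp add: scalar_prod_def)
  qed
  have gap: "\<sigma>\<^sub>2 < \<sigma>" using \<delta> by (simp add: \<sigma>_def \<sigma>\<^sub>2_def)
  have s2: "0 \<le> \<sigma>\<^sub>2" unfolding \<sigma>\<^sub>2_def by (rule right_singular_basis_exists[OF A n])
  have s0: "\<sigma> \<noteq> 0" using gap s2 by simp
  have AtA: "A\<^sup>T *\<^sub>v (A *\<^sub>v v) = \<sigma>\<^sup>2 \<cdot>\<^sub>v v"
    unfolding Av using mult_mat_vec[of "A\<^sup>T" n n u \<sigma>] A u Au
    by (simp add: smult_smult_assoc power2_eq_square)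
  have second: "vnorm (A *\<^sub>v x) \<le> \<sigma>\<^sub>2 * vnorm x" if "x \<in> carrier_vec n" "v \<bullet> x = 0" for x
    using vnorm_mult_le_second_singular_value[OF A n _ v, unfolded sdefs, OF gap AtA that] .
  \<comment> \<open>The same bound for the transpose: \<open>A\<^sup>T\<close> maps the complement of \<open>u\<close> into the complement of \<open>v\<close>,
    and \<open>|A\<^sup>T y|\<^sup>2 = y \<bullet> A A\<^sup>T y\<close>.\<close>
  have second_t: "vnorm (A\<^sup>T *\<^sub>v y) \<le> \<sigma>\<^sub>2 * vnorm y" if y: "y \<in> carrier_vec n" "u \<bullet> y = 0" for y
  proof -
    let ?z = "A\<^sup>T *\<^sub>v y"
    have z: "?z \<in> carrier_vec n" using A y by simp
    have "v \<bullet> ?z = (A *\<^sub>v v) \<bullet> y" using scalar_prod_mult_mat_vec[of "A\<^sup>T" n n v y] A v y by simp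
    then have vz: "v \<bullet> ?z = 0" unfolding Av using u y by (simp add: smult_scalar_prod_distrib[of _ n])
    have "vnorm ?z * vnorm ?z = y \<bullet> (A *\<^sub>v ?z)"
      unfolding vnorm_mult_self by (rule scalar_prod_mult_mat_vec[OF A y(1) z, symmetric])
    also have "\<dots> \<le> vnorm y * vnorm (A *\<^sub>v ?z)" using A y z by (intro Cauchy_Schwarz_vec[of _ n]) auto
    also have "\<dots> \<le> vnorm y * (\<sigma>\<^sub>2 * vnorm ?z)" using second[OF z vz] by (intro mult_left_mono) auto
    finally have "vnorm ?z * vnorm ?z \<le> (\<sigma>\<^sub>2 * vnorm y) * vnorm ?z" by (simp add: ac_simps)
    then show ?thesis using s2 vnorm_nonneg[of ?z]
      by (cases "vnorm ?z = 0") (auto simp: mult_le_cancel_right)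
  qed
  have Uu: "U *\<^sub>v (U\<^sup>T *\<^sub>v u) = u"
    by (rule range_contains_singular_vector[OF A U kerU u(1) v(1) Av s0])
  have Vv: "V *\<^sub>v (V\<^sup>T *\<^sub>v v) = v"
    by (rule range_contains_singular_vector[of "A\<^sup>T", OF _ V _ v(1) u(1) Au s0]) (use A kerV in auto)
  define \<kappa> \<tau> where "\<kappa> = K * sqrt (real n)" and "\<tau> = K * sqrt (real r)"
  have kt: "0 \<le> \<kappa>" "0 \<le> \<tau>" using K by (auto simp: \<kappa>_def \<tau>_def)
  have E_t: "x \<bullet> (E\<^sup>T *\<^sub>v y) \<le> \<kappa> * (vnorm x * vnorm y)" if "x \<in> carrier_vec n" "y \<in> carrier_vec n" for x y
    using scalar_prod_mult_mat_vec[of "E\<^sup>T" n n x y] comm_scalar_prod[of "E *\<^sub>v x" n y] E_le[OF that(2,1)] E that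
    by (simp add: \<kappa>_def ac_simps)
  have UEV_t: "(V *\<^sub>v x) \<bullet> (E\<^sup>T *\<^sub>v (U *\<^sub>v y)) \<le> \<tau> * (vnorm x * vnorm y)"
    if "x \<in> carrier_vec r" "y \<in> carrier_vec r" for x y
    using scalar_prod_mult_mat_vec[of "E\<^sup>T" n n "V *\<^sub>v x" "U *\<^sub>v y"]
      comm_scalar_prod[of "E *\<^sub>v (V *\<^sub>v x)" n "U *\<^sub>v y"] UEV_le[OF that(2,1)] E U V that
    by (simp add: \<tau>_def ac_simps)
  define p where "p = U *\<^sub>v (U\<^sup>T *\<^sub>v u') - (u \<bullet> u') \<cdot>\<^sub>v u"
  define q where "q = u' - U *\<^sub>v (U\<^sup>T *\<^sub>v u')"
  define s where "s = V *\<^sub>v (V\<^sup>T *\<^sub>v v') - (v \<bullet> v') \<cdot>\<^sub>v v"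
  define w where "w = v' - V *\<^sub>v (V\<^sup>T *\<^sub>v v')"
  note wp = perturbed_singular_vector_bounds[OF A E U V kerV u Uu v Vv Av second u' v' eq1 eq2 kt
        E_le[folded \<kappa>_def] UEV_le[folded \<tau>_def], folded p_def s_def w_def]
  have w_le: "\<sigma>' * vnorm w \<le> \<kappa>" by (rule wp(1))
  have p_le: "\<sigma>' * vnorm p \<le> \<sigma>\<^sub>2 * vnorm s + \<tau> + \<kappa> * vnorm w" by (rule wp(2))
  have AEt: "(A + E)\<^sup>T = A\<^sup>T + E\<^sup>T" by (rule transpose_add[OF A E])
  have AEt': "(A\<^sup>T + E\<^sup>T)\<^sup>T = A + E" using AEt transpose_transpose[of "A + E"] by simp
  have At: "A\<^sup>T \<in> carrier_mat n n" and Et: "E\<^sup>T \<in> carrier_mat n n" using A E by auto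
  \<comment> \<open>The same bounds for the transposed problem, with left and right
    exchanged.\<close>
  note qs = perturbed_singular_vector_bounds[OF At Et V U kerU v Vv u Uu Au second_t v' u'
        eq2[unfolded AEt] eq1[folded AEt'] kt E_t UEV_t, folded p_def s_def q_def]
  have q_le: "\<sigma>' * vnorm q \<le> \<kappa>" by (rule qs(1))
  have s_le: "\<sigma>' * vnorm s \<le> \<sigma>\<^sub>2 * vnorm p + \<tau> + \<kappa> * vnorm q" by (rule qs(2))
  \<comment> \<open>The form of \<open>A + E\<close> at \<open>u\<close>, \<open>v\<close> is a
    lower bound for \<open>\<sigma>'\<close>. As \<open>u\<close> and \<open>v\<close> lie in the
    ranges of \<open>U\<close> and \<open>V\<close>, the loss is the compression bound
    \<open>\<tau>\<close> instead of \<open>\<kappa>\<close>; the factor -1 turns the upper bound on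
    the form into a lower one.\<close>
  have \<sigma>'_ge: "\<sigma> - \<tau> \<le> \<sigma>'"
  proof -
    let ?a = "U\<^sup>T *\<^sub>v u" and ?b = "V\<^sup>T *\<^sub>v v"
    have ab: "?a \<in> carrier_vec r" "?b \<in> carrier_vec r" using U V u v by auto
    have Ev: "E *\<^sub>v v \<in> carrier_vec n" "A *\<^sub>v v \<in> carrier_vec n" using A E v by auto
    have "(U *\<^sub>v (- 1 \<cdot>\<^sub>v ?a)) \<bullet> (E *\<^sub>v (V *\<^sub>v ?b)) \<le> \<tau> * (vnorm (- 1 \<cdot>\<^sub>v ?a) * vnorm ?b)"
      using UEV_le[of "- 1 \<cdot>\<^sub>v ?a" ?b] ab by (simp add: \<tau>_def)
    moreover have "U *\<^sub>v (- 1 \<cdot>\<^sub>v ?a) = - 1 \<cdot>\<^sub>v u" using mult_mat_vec[OF U(1) ab(1), of "-1"] Uu by simp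
    moreover have "vnorm (- 1 \<cdot>\<^sub>v ?a) = vnorm ?a" by (simp add: vnorm_smult)
    moreover have "(- 1 \<cdot>\<^sub>v u) \<bullet> (E *\<^sub>v v) = - (u \<bullet> (E *\<^sub>v v))"
      using smult_scalar_prod_distrib[OF u(1) Ev(1), of "-1"] by simp
    ultimately have "- (u \<bullet> (E *\<^sub>v v)) \<le> \<tau> * (vnorm ?a * vnorm ?b)" unfolding Vv by simp
    also have "\<dots> \<le> \<tau> * (1 * 1)"
      using vnorm_transpose_isometry_le[OF U u(1)] vnorm_transpose_isometry_le[OF V v(1)] u1 v1 kt
      by (intro mult_left_mono mult_mono) auto
    finally have "- \<tau> \<le> u \<bullet> (E *\<^sub>v v)" by simp
    moreover have "u \<bullet> ((A + E) *\<^sub>v v) = \<sigma> + u \<bullet> (E *\<^sub>v v)"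
      unfolding add_mult_distrib_mat_vec[OF A E v(1)] scalar_prod_add_distrib[OF u(1) Ev(2,1)]
      unfolding Av using u by (simp add: scalar_prod_smult_distrib[of _ n])
    moreover have "u \<bullet> ((A + E) *\<^sub>v v) \<le> vnorm u * vnorm ((A + E) *\<^sub>v v)"
      using AE u v by (intro Cauchy_Schwarz_vec[of _ n]) auto
    moreover have "vnorm ((A + E) *\<^sub>v v) \<le> \<sigma>'"
      using vnorm_mult_le_singular_value[OF AE n v(1)] v1 by (simp add: \<sigma>'_def)
    ultimately show ?thesis using u1 by simp
  qed
  note decU = range_decomposition[OF U u Uu u'(1), folded p_def q_def]
  note decV = range_decomposition[OF V v Vv v'(1), folded s_def w_def]
  have sin_le: "sin (vec_angle a b) \<le> vnorm x + vnorm y"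
    if "a \<in> carrier_vec n" "b \<in> carrier_vec n" "a \<bullet> a = 1" "b \<bullet> b = 1"
      "b \<bullet> b - (a \<bullet> b)\<^sup>2 = x \<bullet> x + y \<bullet> y" for a b x y
  proof -
    have "sin (vec_angle a b) = sqrt ((vnorm x)\<^sup>2 + (vnorm y)\<^sup>2)"
      using sin_vec_angle[OF that(1-4)] that(4,5) by (simp add: vnorm_square)
    also have "\<dots> \<le> vnorm x + vnorm y" by (rule sqrt_sum_squares_le_sum) auto
    finally show ?thesis .
  qed
  have R: "1 \<le> sqrt (real r)" using r by simp
  have K2: "2 * K \<le> 8 * K\<^sup>2 + 6 * K" using K by (simp add: add_nonneg_nonneg)
  have d': "\<delta> = \<sigma> - \<sigma>\<^sub>2" and n1: "(sqrt (real n))\<^sup>2 \<le> \<sigma>" and n2: "sqrt (real n) * \<delta> \<le> \<sigma>"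
    and n0: "0 \<le> sqrt (real n)"
    using \<delta>(1) \<sigma> by (simp_all add: \<sigma>_def \<sigma>\<^sub>2_def)
  have *: "vnorm p + vnorm q \<le> (8 * K\<^sup>2 + 6 * K) * sqrt (real r) / \<delta> \<and>
      vnorm s + vnorm w \<le> (8 * K\<^sup>2 + 6 * K) * sqrt (real r) / \<delta>" if "2 * (K * sqrt (real r)) \<le> \<delta>"
    by (intro conjI; rule gap_arithmetic[OF K R n0 that d' s2 n1 n2 \<sigma>'_ge[unfolded \<tau>_def]
          vnorm_nonneg vnorm_nonneg vnorm_nonneg vnorm_nonneg q_le[unfolded \<kappa>_def] w_le[unfolded \<kappa>_def]
          p_le[unfolded \<kappa>_def \<tau>_def] s_le[unfolded \<kappa>_def \<tau>_def]])
  \<comment> \<open>For a gap below this threshold the claimed bound exceeds 1 and holds for every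
    angle.\<close>
  have **: "1 \<le> (8 * K\<^sup>2 + 6 * K) * sqrt (real r) / \<delta>" if "\<not> 2 * (K * sqrt (real r)) \<le> \<delta>"
  proof -
    have "\<delta> \<le> 2 * K * sqrt (real r)" using that by simp
    also have "\<dots> \<le> (8 * K\<^sup>2 + 6 * K) * sqrt (real r)" using K2 by (intro mult_right_mono) auto
    finally show ?thesis using \<delta>(2) by (simp add: pos_le_divide_eq)
  qed
  show "sin (vec_angle u u') \<le> (8 * K\<^sup>2 + 6 * K) * sqrt (real r) / \<delta>"
    using * ** sin_le[OF u(1) u'(1) u(2) u'(2) decU(6)] sin_le_one[of "vec_angle u u'"] by linarith
  show "sin (vec_angle v v') \<le> (8 * K\<^sup>2 + 6 * K) * sqrt (real r) / \<delta>"
    using * ** sin_le[OF v(1) v'(1) v(2) v'(2) decV(6)] sin_le_one[of "vec_angle v v'"] by linarith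
qed

section \<open>Combination with the random bounds\<close>

theorem theorem9:
  fixes \<epsilon> :: real
  assumes "\<epsilon> > 0"
  shows "\<exists>C\<^sub>0 > 0. \<exists>\<delta>\<^sub>0 > 0.
    \<forall>(n::nat) (r::nat) (A::real mat) (\<sigma>\<^sub>1::real) (\<delta>::real).
      \<forall>singular_vector \<in> {left_singular_vector, right_singular_vector}.
      A \<in> carrier_mat n n \<longrightarrow>
      vec_space.rank n A = r \<longrightarrow>
      \<sigma>\<^sub>1 = singular_value A 1 \<longrightarrow>
      \<delta> = \<sigma>\<^sub>1 - singular_value A 2 \<longrightarrow>
      \<delta> \<ge> \<delta>\<^sub>0 \<longrightarrow>
      \<sigma>\<^sub>1 \<ge> max (real n) (sqrt (real n) * \<delta>) \<longrightarrow>
      measure_pmf.prob (bernoulli_matrix_pmf n)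
        {E. \<forall>v\<^sub>1 v\<^sub>1'. singular_vector A \<sigma>\<^sub>1 v\<^sub>1 \<longrightarrow>
              singular_vector (A + E) (singular_value (A + E) 1) v\<^sub>1' \<longrightarrow>
              sin (vec_angle v\<^sub>1 v\<^sub>1') \<le> C\<^sub>0 * sqrt (real r) / \<delta>}
        \<ge> 1 - \<epsilon>"
proof -
  obtain K where K: "K > 0" and bound: "\<And>n r U V. r > 0 \<Longrightarrow> U \<in> carrier_mat n r \<Longrightarrow> V \<in> carrier_mat n r \<Longrightarrow>
      U\<^sup>T * U = 1\<^sub>m r \<Longrightarrow> V\<^sup>T * V = 1\<^sub>m r \<Longrightarrow>
      measure_pmf.prob (bernoulli_matrix_pmf n)
        {E. \<not> (\<forall>x\<in>carrier_vec r. \<forall>y\<in>carrier_vec r.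
          (U *\<^sub>v x) \<bullet> (E *\<^sub>v (V *\<^sub>v y)) \<le> K * sqrt (real r) * (vnorm x * vnorm y))} \<le> \<epsilon> / 2"
  \<comment> \<open>Two exceptional events occur below, for the compression and for the full matrix;
    each receives half of \<open>\<epsilon>\<close>.\<close>
  proof (rule bernoulli_compression_bound[of "\<epsilon> / 2"])
    show "\<epsilon> / 2 > 0" using assms by simp
  qed (rule that)
  define C where "C = 8 * K\<^sup>2 + 6 * K"
  have C: "C > 0" using K by (simp add: C_def add_nonneg_pos)
  show ?thesis
  proof (intro exI conjI allI ballI impI)
    show "0 < C" by fact
    show "0 < (1::real)" by simp
    fix n r :: nat and A :: "real mat" and \<sigma>\<^sub>1 \<delta> :: real
      and singular_vector :: "real mat \<Rightarrow> real \<Rightarrow> real Matrix.vec \<Rightarrow> bool"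
    assume sv: "singular_vector \<in> {left_singular_vector, right_singular_vector}"
      and A: "A \<in> carrier_mat n n" and r: "vec_space.rank n A = r"
      and \<sigma>\<^sub>1: "\<sigma>\<^sub>1 = singular_value A 1" and \<delta>: "\<delta> = \<sigma>\<^sub>1 - singular_value A 2" "1 \<le> \<delta>"
      and \<sigma>_ge: "max (real n) (sqrt (real n) * \<delta>) \<le> \<sigma>\<^sub>1"
    let ?p = "bernoulli_matrix_pmf n"
    let ?S = "{E. \<forall>v\<^sub>1 v\<^sub>1'. singular_vector A \<sigma>\<^sub>1 v\<^sub>1 \<longrightarrow>
              singular_vector (A + E) (singular_value (A + E) 1) v\<^sub>1' \<longrightarrow>
              sin (vec_angle v\<^sub>1 v\<^sub>1') \<le> C * sqrt (real r) / \<delta>}"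
    show "measure_pmf.prob ?p ?S \<ge> 1 - \<epsilon>"
    \<comment> \<open>Without a singular pair, as for \<open>n = 0\<close>, the event is the whole
      space. Otherwise the pair witnesses \<open>n > 0\<close> and \<open>k > 0\<close>.\<close>
    proof (cases "\<exists>u v. singular_pair A \<sigma>\<^sub>1 u v")
      case False
      then have "?S = UNIV"
        using sv by (auto simp: left_singular_vector_def right_singular_vector_def)
      then show ?thesis using assms by simp
    next
      case True
      then obtain u v where u: "u \<in> carrier_vec n" "u \<bullet> u = 1" and v: "v \<in> carrier_vec n"
        and Av: "A *\<^sub>v v = \<sigma>\<^sub>1 \<cdot>\<^sub>v u"
        using A by (auto simp: singular_pair_def unit_vector_def)
      have n: "n > 0"
      proof (rule ccontr)
        assume "\<not> n > 0"
        then show False using u by (simp add: scalar_prod_def)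
      qed
      then have "\<sigma>\<^sub>1 > 0" using \<sigma>_ge by simp
      obtain k U V where k: "k \<le> r" and U: "U \<in> carrier_mat n k" "U\<^sup>T * U = 1\<^sub>m k"
        and V: "V \<in> carrier_mat n k" "V\<^sup>T * V = 1\<^sub>m k"
        and kerU: "\<And>y. y \<in> carrier_vec n \<Longrightarrow> U\<^sup>T *\<^sub>v y = 0\<^sub>v k \<Longrightarrow> A\<^sup>T *\<^sub>v y = 0\<^sub>v n"
        and kerV: "\<And>x. x \<in> carrier_vec n \<Longrightarrow> V\<^sup>T *\<^sub>v x = 0\<^sub>v k \<Longrightarrow> A *\<^sub>v x = 0\<^sub>v n"
        by (rule reduced_orthonormal_bases_exist[OF A n, unfolded r]) (rule that)
      have k0: "k > 0"
      proof (rule ccontr)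
        assume "\<not> k > 0"
        then have "V\<^sup>T *\<^sub>v v = 0\<^sub>v k" using V(1) by (intro eq_vecI) auto
        then have "A *\<^sub>v v = 0\<^sub>v n" by (rule kerV[OF v])
        then have "\<sigma>\<^sub>1 * (u \<bullet> u) = 0"
          using smult_scalar_prod_distrib[OF u(1) u(1), of \<sigma>\<^sub>1] u(1) unfolding Av by simp
        then show False using u(2) \<open>\<sigma>\<^sub>1 > 0\<close> by simp
      qed
      \<comment> \<open>The event is parametrised because it is used for \<open>U\<close>,
        \<open>V\<close> of width \<open>k\<close> and for identity matrices, where it controls the
        operator norm of \<open>E\<close>.\<close>
      define bad where "bad r U V = {E. \<not> (\<forall>x\<in>carrier_vec r. \<forall>y\<in>carrier_vec r.
          (U *\<^sub>v x) \<bullet> (E *\<^sub>v (V *\<^sub>v y)) \<le> K * sqrt (real r) * (vnorm x * vnorm y))}"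
        for r and U V :: "real mat"
      have good: "E \<in> ?S" if E: "E \<in> set_pmf ?p" "E \<notin> bad k U V" "E \<notin> bad n (1\<^sub>m n) (1\<^sub>m n)" for E
      proof -
        have Ec: "E \<in> carrier_mat n n" using E(1) by (auto simp: bernoulli_matrix_pmf_def)
        have E_le: "x \<bullet> (E *\<^sub>v y) \<le> K * sqrt (real n) * (vnorm x * vnorm y)"
          if "x \<in> carrier_vec n" "y \<in> carrier_vec n" for x y
          using E(3) that by (auto simp: bad_def)
        have UEV_le: "(U *\<^sub>v x) \<bullet> (E *\<^sub>v (V *\<^sub>v y)) \<le> K * sqrt (real k) * (vnorm x * vnorm y)"
          if "x \<in> carrier_vec k" "y \<in> carrier_vec k" for x y
          using E(2) that by (auto simp: bad_def)
        have "\<delta> = singular_value A 1 - singular_value A 2" "\<delta> > 0" "real n \<le> singular_value A 1"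
          "sqrt (real n) * \<delta> \<le> singular_value A 1"
          using \<delta> \<sigma>_ge \<sigma>\<^sub>1 by auto
        note perturb = singular_vector_perturbation[OF A Ec k0 U V kerU kerV K E_le UEV_le this]
        have le: "C * sqrt (real k) / \<delta> \<le> C * sqrt (real r) / \<delta>"
          using k C \<delta>(2) by (intro divide_right_mono mult_left_mono) auto
        show ?thesis
        proof (rule CollectI, intro allI impI)
          fix v\<^sub>1 v\<^sub>1'
          assume *: "singular_vector A \<sigma>\<^sub>1 v\<^sub>1" "singular_vector (A + E) (singular_value (A + E) 1) v\<^sub>1'"
          have "sin (vec_angle v\<^sub>1 v\<^sub>1') \<le> C * sqrt (real k) / \<delta>"
          proof (cases "singular_vector = left_singular_vector")
            case True
            then show ?thesis using * perturb(1) unfolding C_def left_singular_vector_def \<sigma>\<^sub>1 by blast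
          next
            case False
            then have "singular_vector = right_singular_vector" using sv by simp
            then show ?thesis using * perturb(2) unfolding C_def right_singular_vector_def \<sigma>\<^sub>1 by blast
          qed
          then show "sin (vec_angle v\<^sub>1 v\<^sub>1') \<le> C * sqrt (real r) / \<delta>" using le by linarith
        qed
      qed
      have "1 - measure_pmf.prob ?p ?S = measure_pmf.prob ?p (- ?S)"
        using measure_pmf.prob_compl[of ?S ?p] by (simp add: Compl_eq_Diff_UNIV)
      also have "\<dots> = measure_pmf.prob ?p (- ?S \<inter> set_pmf ?p)" by (simp only: measure_Int_set_pmf)
      also have "\<dots> \<le> measure_pmf.prob ?p (bad k U V \<union> bad n (1\<^sub>m n) (1\<^sub>m n))"
        using good by (intro measure_pmf.finite_measure_mono) auto
      also have "\<dots> \<le> measure_pmf.prob ?p (bad k U V) + measure_pmf.prob ?p (bad n (1\<^sub>m n) (1\<^sub>m n))"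
        by (rule measure_Un_le) auto
      also have "\<dots> \<le> \<epsilon> / 2 + \<epsilon> / 2"
        unfolding bad_def using k0 n U V by (intro add_mono bound) auto
      finally show ?thesis by simp
    qed
  qed
qed

end
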